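(* Let $(\mathcal A,F,\lambda)$ be a (left) bimonad and $B:\mathcal A\to\mathcal A$ a monad in a 2-category $\mathcal K$, and let $(F,\psi_{B,F})$ be an object of $\mathcal T(\mathcal A,B)$. Then there is an action of categories $${}_{\psi_B}{}^F_F\mathcal{YD}_s(\mathcal K,\mathcal A)\times{}^F_B\mathcal K\to{}^F_B\mathcal K,\qquad (X,M)\mapsto XM,$$ where $XM$ is a left $F$-comodule by $(\phi_{X,F}\times M)\circ(X\times\lambda_M)$ ($\lambda_M:M\to FM$ being the $F$-coaction of $M$) and a left $B$-module by $(X\times\nu_M)\circ(\psi_{B,X}\times M)$ ($\nu_M:BM\to M$ being the $B$-action of $M$).
   Context: Conventions: 1-cells are composed by juxtaposition, $\times$ is horizontal and $\circ$ (or juxtaposition) vertical composition of 2-cells; a 1-cell in a formula stands for its identity 2-cell. For a monad $B$ on $\mathcal A$, $\mathcal T(\mathcal A,B)=\mathrm{Mnd}(\mathcal K)(B)$ has objects $(X,\psi)$, $X:\mathcal A\to\mathcal A$, $\psi:BX\to XB$ with $\psi(\mu_B\times X)=(X\times\mu_B)(\psi\times B)(B\times\psi)$, $\psi(\eta_B\times X)=X\times\eta_B$; morphisms are 2-cells $\zeta:X\to Y$ with $(\zeta\times B)\psi=\psi'(B\times\zeta)$. For a comonad $F$ on $\mathcal A$, $\mathrm{Comnd}(\mathcal K)(F)$ has objects $(X,\phi)$, $\phi:XF\to FX$ with $(\Delta\times X)\phi=(F\times\phi)(\phi\times F)(X\times\Delta)$, $(\varepsilon\times X)\phi=X\times\varepsilon$;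 morphisms are $\zeta$ with $(F\times\zeta)\phi=\phi'(\zeta\times F)$. A (left) bimonad $(\mathcal A,F,\mu,\eta,\Delta,\varepsilon,\lambda)$: $(F,\mu,\eta)$ a monad, $(F,\Delta,\varepsilon)$ a comonad, $\lambda:FF\to FF$ with $(F,\lambda)\in\mathrm{Mnd}(\mathcal K)(F)$ and $(F,\lambda)\in\mathrm{Comnd}(\mathcal K)(F)$, and $\Delta\mu=(F\times\mu)(\lambda\times F)(F\times\Delta)$, $\varepsilon\mu=\varepsilon\times\varepsilon$, $\Delta\eta=\eta\times\eta$, $\varepsilon\eta=\mathrm{Id}$. A strong Yetter–Drinfel'd module over $F$ is $(X,\psi_{F,X},\phi_{X,F})$ with $(X,\psi_{F,X})\in\mathrm{Mnd}(\mathcal K)(F)$, $(X,\phi_{X,F})\in\mathrm{Comnd}(\mathcal K)(F)$ and $(\phi_{X,F}\times F)(X\times\lambda)(\psi_{F,X}\times F)=(F\times\psi_{F,X})(\lambda\times X)(F\times\phi_{X,F})$. ${}_{\psi_B}{}^F_F\mathcal{YD}_s(\mathcal K,\mathcal A)$: objects are strong Yetter–Drinfel'd modules together with $\psi_{B,X}:BX\to XB$ such that $(X,\psi_{B,X})\in\mathcal T(\mathcal A,B)$ and $(X\times\psi_{B,F})(\psi_{B,X}\times F)(B\times\psi_{F,X})=(\psi_{F,X}\times B)(F\times\psi_{B,X})(\psi_{B,F}\times X)$, $(F\times\psi_{B,X})(\psi_{B,F}\times X)(B\times\phi_{X,F})=(\phi_{X,F}\times B)(X\times\psi_{B,F})(\psi_{B,X}\times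 F)$. Morphisms are 2-cells that are morphisms in $\mathrm{Mnd}(\mathcal K)(F)$, $\mathrm{Comnd}(\mathcal K)(F)$ and $\mathrm{Mnd}(\mathcal K)(B)$. It is monoidal with tensor product $XY$, $\psi_{-,XY}=(X\times\psi_{-,Y})(\psi_{-,X}\times Y)$, $\phi_{XY,F}=(\phi_{X,F}\times Y)(X\times\phi_{Y,F})$. ${}^F_B\mathcal K$, the category of left relative $(F,B)$-modules: objects are 1-cells $M:\mathcal A'\to\mathcal A$ (any 0-cell $\mathcal A'$) that are left $F$-comodules $(M,\lambda_M)$ and left $B$-modules $(M,\nu_M)$ with $\lambda_M\nu_M=(F\times\nu_M)(\psi_{B,F}\times M)(B\times\lambda_M)$; morphisms are left $F$-colinear, left $B$-linear 2-cells. *)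

theory Defs
  imports Main
begin

section \<open>Categories and strict monoidal categories\<close>

text \<open>
  Categories are given by families of hom-sets that need not be disjoint: one and the same
  2-cell may be a morphism between many different structured objects, so source and target
  are not recorded in a morphism.  \<open>Cmp C g f\<close> is ``\<open>g\<close> after \<open>f\<close>''.
\<close>

record ('a, 'm) category =
  Ob  :: "'a set"
  Hom :: "'a \<Rightarrow> 'a \<Rightarrow> 'm set"
  Cmp :: "'m \<Rightarrow> 'm \<Rightarrow> 'm"
  Idn :: "'a \<Rightarrow> 'm"

locale category =
  fixes C :: "('a, 'm, 'z) category_scheme"
  assumes Idn_in_Hom: "a \<in> Ob C \<Longrightarrow> Idn C a \<in> Hom C a a"
    and Cmp_in_Hom: "\<lbrakk>a \<in> Ob C; b \<in> Ob C; c \<in> Ob C; f \<in> Hom C a b; g \<in> Hom C b c\<rbrakk>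
        \<Longrightarrow> Cmp C g f \<in> Hom C a c"
    and Cmp_Idn_left: "\<lbrakk>a \<in> Ob C; b \<in> Ob C; f \<in> Hom C a b\<rbrakk> \<Longrightarrow> Cmp C (Idn C b) f = f"
    and Cmp_Idn_right: "\<lbrakk>a \<in> Ob C; b \<in> Ob C; f \<in> Hom C a b\<rbrakk> \<Longrightarrow> Cmp C f (Idn C a) = f"
    and Cmp_assoc: "\<lbrakk>a \<in> Ob C; b \<in> Ob C; c \<in> Ob C; d \<in> Ob C;
          f \<in> Hom C a b; g \<in> Hom C b c; h \<in> Hom C c d\<rbrakk>
        \<Longrightarrow> Cmp C h (Cmp C g f) = Cmp C (Cmp C h g) f"

definition prod_category ::
    "('a, 'm, 'y) category_scheme \<Rightarrow> ('b, 'n, 'z) category_scheme \<Rightarrow> ('a \<times> 'b, 'm \<times> 'n) category"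
  where "prod_category C D =
    \<lparr> Ob = Ob C \<times> Ob D,
      Hom = (\<lambda>(a, b) (a', b'). Hom C a a' \<times> Hom D b b'),
      Cmp = (\<lambda>(g, k) (f, h). (Cmp C g f, Cmp D k h)),
      Idn = (\<lambda>(a, b). (Idn C a, Idn D b)) \<rparr>"

locale cat_functor = C: category C + D: category D
  for C :: "('a, 'm, 'y) category_scheme" and D :: "('b, 'n, 'z) category_scheme" +
  fixes F0 :: "'a \<Rightarrow> 'b" and F1 :: "'m \<Rightarrow> 'n"
  assumes F0_in_Ob: "a \<in> Ob C \<Longrightarrow> F0 a \<in> Ob D"
    and F1_in_Hom: "\<lbrakk>a \<in> Ob C; b \<in> Ob C; f \<in> Hom C a b\<rbrakk> \<Longrightarrow> F1 f \<in> Hom D (F0 a) (F0 b)"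
    and F1_Idn: "a \<in> Ob C \<Longrightarrow> F1 (Idn C a) = Idn D (F0 a)"
    and F1_Cmp: "\<lbrakk>a \<in> Ob C; b \<in> Ob C; c \<in> Ob C; f \<in> Hom C a b; g \<in> Hom C b c\<rbrakk>
        \<Longrightarrow> F1 (Cmp C g f) = Cmp D (F1 g) (F1 f)"

record ('a, 'm) monoidal_category = "('a, 'm) category" +
  Tens0 :: "'a \<times> 'a \<Rightarrow> 'a"
  Tens1 :: "'m \<times> 'm \<Rightarrow> 'm"
  Unit  :: 'a

locale strict_monoidal_category = category C
  for C :: "('a, 'm, 'z) monoidal_category_scheme" +
  assumes Tens_functor: "cat_functor (prod_category C C) C (Tens0 C) (Tens1 C)"
    and Unit_in_Ob: "Unit C \<in> Ob C"
    and Tens0_assoc: "\<lbrakk>a \<in> Ob C; b \<in> Ob C; c \<in> Ob C\<rbrakk>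
        \<Longrightarrow> Tens0 C (Tens0 C (a, b), c) = Tens0 C (a, Tens0 C (b, c))"
    and Tens1_assoc: "\<lbrakk>a \<in> Ob C; b \<in> Ob C; c \<in> Ob C; a' \<in> Ob C; b' \<in> Ob C; c' \<in> Ob C;
          f \<in> Hom C a a'; g \<in> Hom C b b'; h \<in> Hom C c c'\<rbrakk>
        \<Longrightarrow> Tens1 C (Tens1 C (f, g), h) = Tens1 C (f, Tens1 C (g, h))"
    and Tens0_Unit_left: "a \<in> Ob C \<Longrightarrow> Tens0 C (Unit C, a) = a"
    and Tens0_Unit_right: "a \<in> Ob C \<Longrightarrow> Tens0 C (a, Unit C) = a"
    and Tens1_Unit_left: "\<lbrakk>a \<in> Ob C; b \<in> Ob C; f \<in> Hom C a b\<rbrakk>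
        \<Longrightarrow> Tens1 C (Idn C (Unit C), f) = f"
    and Tens1_Unit_right: "\<lbrakk>a \<in> Ob C; b \<in> Ob C; f \<in> Hom C a b\<rbrakk>
        \<Longrightarrow> Tens1 C (f, Idn C (Unit C)) = f"

text \<open>
  An action of a monoidal category \<open>C\<close> on a category \<open>D\<close>: a functor \<open>C \<times> D \<rightarrow> D\<close> compatible
  with the tensor product and the unit of \<open>C\<close>.  Over a strict 2-category the compatibility
  isomorphisms \<open>(x \<otimes> y) m \<cong> x (y m)\<close> and \<open>I m \<cong> m\<close> are identities, so only this
  strict case is introduced; the coherence conditions are then vacuous.  Naturality of these
  identities is the agreement of the two sides on morphisms.
\<close>

locale strict_action = C: strict_monoidal_category C + D: category D
  for C :: "('a, 'm, 'y) monoidal_category_scheme" and D :: "('b, 'n, 'z) category_scheme" +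
  fixes act0 :: "'a \<times> 'b \<Rightarrow> 'b" and act1 :: "'m \<times> 'n \<Rightarrow> 'n"
  assumes act_functor: "cat_functor (prod_category C D) D act0 act1"
    and act0_Tens: "\<lbrakk>x \<in> Ob C; y \<in> Ob C; m \<in> Ob D\<rbrakk>
        \<Longrightarrow> act0 (Tens0 C (x, y), m) = act0 (x, act0 (y, m))"
    and act1_Tens: "\<lbrakk>x \<in> Ob C; x' \<in> Ob C; y \<in> Ob C; y' \<in> Ob C; m \<in> Ob D; m' \<in> Ob D;
          f \<in> Hom C x x'; g \<in> Hom C y y'; h \<in> Hom D m m'\<rbrakk>
        \<Longrightarrow> act1 (Tens1 C (f, g), h) = act1 (f, act1 (g, h))"
    and act0_Unit: "m \<in> Ob D \<Longrightarrow> act0 (Unit C, m) = m"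
    and act1_Unit: "\<lbrakk>m \<in> Ob D; m' \<in> Ob D; h \<in> Hom D m m'\<rbrakk>
        \<Longrightarrow> act1 (Idn C (Unit C), h) = h"

section \<open>2-categories\<close>

text \<open>
  \<open>g \<cdot> f\<close> is the juxtaposition of 1-cells (\<open>f\<close> is applied first), \<open>\<star>\<close> is horizontal and
  \<open>\<bullet>\<close> vertical composition of 2-cells.
\<close>

record ('o, 'f, 'c) two_category =
  Cell0 :: "'o set"
  Cell1 :: "'f set"
  Cell2 :: "'c set"
  src   :: "'f \<Rightarrow> 'o"
  trg   :: "'f \<Rightarrow> 'o"
  dom2  :: "'c \<Rightarrow> 'f"
  cod2  :: "'c \<Rightarrow> 'f"
  comp1 :: "'f \<Rightarrow> 'f \<Rightarrow> 'f"  (infixl \<open>\<cdot>\<index>\<close> 80)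
  id1   :: "'o \<Rightarrow> 'f"
  hcomp :: "'c \<Rightarrow> 'c \<Rightarrow> 'c"  (infixl \<open>\<star>\<index>\<close> 75)
  vcomp :: "'c \<Rightarrow> 'c \<Rightarrow> 'c"  (infixl \<open>\<bullet>\<index>\<close> 70)
  id2   :: "'f \<Rightarrow> 'c"

definition hom1 :: "('o, 'f, 'c) two_category \<Rightarrow> 'o \<Rightarrow> 'o \<Rightarrow> 'f set"
  where "hom1 K a b = {f \<in> Cell1 K. src K f = a \<and> trg K f = b}"

definition hom2 :: "('o, 'f, 'c) two_category \<Rightarrow> 'f \<Rightarrow> 'f \<Rightarrow> 'c set"
  where "hom2 K f g = {\<alpha> \<in> Cell2 K. dom2 K \<alpha> = f \<and> cod2 K \<alpha> = g}"

definition hom_category :: "('o, 'f, 'c) two_category \<Rightarrow> 'o \<Rightarrow> 'o \<Rightarrow> ('f, 'c) category"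
  where "hom_category K a b = \<lparr> Ob = hom1 K a b, Hom = hom2 K, Cmp = vcomp K, Idn = id2 K \<rparr>"

text \<open>A 1-cell in a formula stands for its identity 2-cell.\<close>

abbreviation whisker_left :: "('o, 'f, 'c) two_category \<Rightarrow> 'f \<Rightarrow> 'c \<Rightarrow> 'c"  (infix \<open>\<rhd>\<index>\<close> 75)
  where "f \<rhd>\<^bsub>K\<^esub> \<alpha> \<equiv> id2 K f \<star>\<^bsub>K\<^esub> \<alpha>"

abbreviation whisker_right :: "('o, 'f, 'c) two_category \<Rightarrow> 'c \<Rightarrow> 'f \<Rightarrow> 'c"  (infix \<open>\<lhd>\<index>\<close> 75)
  where "\<alpha> \<lhd>\<^bsub>K\<^esub> f \<equiv> \<alpha> \<star>\<^bsub>K\<^esub> id2 K f"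

locale two_category =
  fixes K :: "('o, 'f, 'c) two_category" (structure)
  assumes src_in: "f \<in> Cell1 K \<Longrightarrow> src K f \<in> Cell0 K"
    and trg_in: "f \<in> Cell1 K \<Longrightarrow> trg K f \<in> Cell0 K"
    and dom2_in: "\<alpha> \<in> Cell2 K \<Longrightarrow> dom2 K \<alpha> \<in> Cell1 K"
    and cod2_in: "\<alpha> \<in> Cell2 K \<Longrightarrow> cod2 K \<alpha> \<in> Cell1 K"
    and parallel: "\<alpha> \<in> Cell2 K \<Longrightarrow>
        src K (dom2 K \<alpha>) = src K (cod2 K \<alpha>) \<and> trg K (dom2 K \<alpha>) = trg K (cod2 K \<alpha>)"
    and hom_category: "\<lbrakk>a \<in> Cell0 K; b \<in> Cell0 K\<rbrakk> \<Longrightarrow> category (hom_category K a b)"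
    and id1_in: "a \<in> Cell0 K \<Longrightarrow> id1 K a \<in> hom1 K a a"
    and comp_functor: "\<lbrakk>a \<in> Cell0 K; b \<in> Cell0 K; c \<in> Cell0 K\<rbrakk> \<Longrightarrow>
        cat_functor (prod_category (hom_category K b c) (hom_category K a b)) (hom_category K a c)
          (\<lambda>(g, f). g \<cdot> f) (\<lambda>(\<beta>, \<alpha>). \<beta> \<star> \<alpha>)"
    and comp1_assoc: "\<lbrakk>f \<in> Cell1 K; g \<in> Cell1 K; h \<in> Cell1 K; src K g = trg K f; src K h = trg K g\<rbrakk>
        \<Longrightarrow> (h \<cdot> g) \<cdot> f = h \<cdot> (g \<cdot> f)"
    and hcomp_assoc: "\<lbrakk>\<alpha> \<in> Cell2 K; \<beta> \<in> Cell2 K; \<gamma> \<in> Cell2 K;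
          src K (dom2 K \<beta>) = trg K (dom2 K \<alpha>); src K (dom2 K \<gamma>) = trg K (dom2 K \<beta>)\<rbrakk>
        \<Longrightarrow> (\<gamma> \<star> \<beta>) \<star> \<alpha> = \<gamma> \<star> (\<beta> \<star> \<alpha>)"
    and comp1_id1_left: "f \<in> Cell1 K \<Longrightarrow> id1 K (trg K f) \<cdot> f = f"
    and comp1_id1_right: "f \<in> Cell1 K \<Longrightarrow> f \<cdot> id1 K (src K f) = f"
    and hcomp_id1_left: "\<alpha> \<in> Cell2 K \<Longrightarrow> id1 K (trg K (dom2 K \<alpha>)) \<rhd> \<alpha> = \<alpha>"
    and hcomp_id1_right: "\<alpha> \<in> Cell2 K \<Longrightarrow> \<alpha> \<lhd> id1 K (src K (dom2 K \<alpha>)) = \<alpha>"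

section \<open>Monads, comonads and their distributive 1-cells\<close>

locale monad = two_category K for K :: "('o, 'f, 'c) two_category" (structure) +
  fixes A :: 'o and B :: 'f and \<mu> \<eta> :: 'c
  assumes monad_base: "A \<in> Cell0 K"
    and monad_carrier: "B \<in> hom1 K A A"
    and mult: "\<mu> \<in> hom2 K (B \<cdot> B) B"
    and unit: "\<eta> \<in> hom2 K (id1 K A) B"
    and mult_assoc: "\<mu> \<bullet> (\<mu> \<lhd> B) = \<mu> \<bullet> (B \<rhd> \<mu>)"
    and mult_unit_left: "\<mu> \<bullet> (\<eta> \<lhd> B) = id2 K B"
    and mult_unit_right: "\<mu> \<bullet> (B \<rhd> \<eta>) = id2 K B"

locale comonad = two_category K for K :: "('o, 'f, 'c) two_category" (structure) +
  fixes A :: 'o and F :: 'f and \<Delta> \<epsilon> :: 'c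
  assumes comonad_base: "A \<in> Cell0 K"
    and comonad_carrier: "F \<in> hom1 K A A"
    and comult: "\<Delta> \<in> hom2 K F (F \<cdot> F)"
    and counit: "\<epsilon> \<in> hom2 K F (id1 K A)"
    and comult_coassoc: "(\<Delta> \<lhd> F) \<bullet> \<Delta> = (F \<rhd> \<Delta>) \<bullet> \<Delta>"
    and comult_counit_left: "(\<epsilon> \<lhd> F) \<bullet> \<Delta> = id2 K F"
    and comult_counit_right: "(F \<rhd> \<epsilon>) \<bullet> \<Delta> = id2 K F"

context
  fixes K :: "('o, 'f, 'c) two_category" (structure)
begin

text \<open>\<open>Mnd K A B \<mu> \<eta>\<close> is also written \<open>\<T>(A, B)\<close>; only endo-1-cells of \<open>A\<close> occur.\<close>

definition Mnd :: "'o \<Rightarrow> 'f \<Rightarrow> 'c \<Rightarrow> 'c \<Rightarrow> ('f \<times> 'c, 'c) category"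
  where "Mnd A B \<mu> \<eta> =
    \<lparr> Ob = {(X, \<psi>). X \<in> hom1 K A A \<and> \<psi> \<in> hom2 K (B \<cdot> X) (X \<cdot> B) \<and>
              \<psi> \<bullet> (\<mu> \<lhd> X) = (X \<rhd> \<mu>) \<bullet> (\<psi> \<lhd> B) \<bullet> (B \<rhd> \<psi>) \<and>
              \<psi> \<bullet> (\<eta> \<lhd> X) = X \<rhd> \<eta>},
      Hom = (\<lambda>(X, \<psi>) (Y, \<psi>'). {\<zeta> \<in> hom2 K X Y. (\<zeta> \<lhd> B) \<bullet> \<psi> = \<psi>' \<bullet> (B \<rhd> \<zeta>)}),
      Cmp = vcomp K,
      Idn = (\<lambda>(X, \<psi>). id2 K X) \<rparr>"

definition Comnd :: "'o \<Rightarrow> 'f \<Rightarrow> 'c \<Rightarrow> 'c \<Rightarrow> ('f \<times> 'c, 'c) category"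
  where "Comnd A F \<Delta> \<epsilon> =
    \<lparr> Ob = {(X, \<phi>). X \<in> hom1 K A A \<and> \<phi> \<in> hom2 K (X \<cdot> F) (F \<cdot> X) \<and>
              (\<Delta> \<lhd> X) \<bullet> \<phi> = (F \<rhd> \<phi>) \<bullet> (\<phi> \<lhd> F) \<bullet> (X \<rhd> \<Delta>) \<and>
              (\<epsilon> \<lhd> X) \<bullet> \<phi> = X \<rhd> \<epsilon>},
      Hom = (\<lambda>(X, \<phi>) (Y, \<phi>'). {\<zeta> \<in> hom2 K X Y. (F \<rhd> \<zeta>) \<bullet> \<phi> = \<phi>' \<bullet> (\<zeta> \<lhd> F)}),
      Cmp = vcomp K,
      Idn = (\<lambda>(X, \<phi>). id2 K X) \<rparr>"

end

section \<open>Bimonads and strong Yetter--Drinfel'd modules\<close>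

locale bimonad = monad K A F \<mu> \<eta> + comonad K A F \<Delta> \<epsilon>
  for K :: "('o, 'f, 'c) two_category" (structure) and A F \<mu> \<eta> \<Delta> \<epsilon> +
  fixes lam :: 'c
  assumes lam_Mnd: "(F, lam) \<in> Ob (Mnd K A F \<mu> \<eta>)"
    and lam_Comnd: "(F, lam) \<in> Ob (Comnd K A F \<Delta> \<epsilon>)"
    and comult_mult: "\<Delta> \<bullet> \<mu> = (F \<rhd> \<mu>) \<bullet> (lam \<lhd> F) \<bullet> (F \<rhd> \<Delta>)"
    and counit_mult: "\<epsilon> \<bullet> \<mu> = \<epsilon> \<star> \<epsilon>"
    and comult_unit: "\<Delta> \<bullet> \<eta> = \<eta> \<star> \<eta>"
    and counit_unit: "\<epsilon> \<bullet> \<eta> = id2 K (id1 K A)"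

locale strong_YD_module = bimonad +
  fixes X \<psi>F \<phi>
  assumes YD_Mnd: "(X, \<psi>F) \<in> Ob (Mnd K A F \<mu> \<eta>)"
    and YD_Comnd: "(X, \<phi>) \<in> Ob (Comnd K A F \<Delta> \<epsilon>)"
    and YD_cond: "(\<phi> \<lhd> F) \<bullet> (X \<rhd> lam) \<bullet> (\<psi>F \<lhd> F) = (F \<rhd> \<psi>F) \<bullet> (lam \<lhd> X) \<bullet> (F \<rhd> \<phi>)"

context
  fixes K :: "('o, 'f, 'c) two_category" (structure)
begin

text \<open>
  An object is \<open>(X, \<psi>F, \<phi>, \<psi>B)\<close> with \<open>\<psi>F : F X \<rightarrow> X F\<close>, \<open>\<phi> : X F \<rightarrow> F X\<close> and
  \<open>\<psi>B : B X \<rightarrow> X B\<close>; the parameter \<open>\<psi>BF : B F \<rightarrow> F B\<close> belongs to the ambient data.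
\<close>

definition YDs ::
    "'o \<Rightarrow> 'f \<Rightarrow> 'c \<Rightarrow> 'c \<Rightarrow> 'c \<Rightarrow> 'c \<Rightarrow> 'c \<Rightarrow> 'f \<Rightarrow> 'c \<Rightarrow> 'c \<Rightarrow> 'c
      \<Rightarrow> ('f \<times> 'c \<times> 'c \<times> 'c, 'c) monoidal_category"
  where "YDs A F \<mu> \<eta> \<Delta> \<epsilon> lam B \<mu>B \<eta>B \<psi>BF =
    \<lparr> Ob = {(X, \<psi>F, \<phi>, \<psi>B).
              strong_YD_module K A F \<mu> \<eta> \<Delta> \<epsilon> lam X \<psi>F \<phi> \<and>
              (X, \<psi>B) \<in> Ob (Mnd K A B \<mu>B \<eta>B) \<and>
              (X \<rhd> \<psi>BF) \<bullet> (\<psi>B \<lhd> F) \<bullet> (B \<rhd> \<psi>F) = (\<psi>F \<lhd> B) \<bullet> (F \<rhd> \<psi>B) \<bullet> (\<psi>BF \<lhd> X) \<and>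
              (F \<rhd> \<psi>B) \<bullet> (\<psi>BF \<lhd> X) \<bullet> (B \<rhd> \<phi>) = (\<phi> \<lhd> B) \<bullet> (X \<rhd> \<psi>BF) \<bullet> (\<psi>B \<lhd> F)},
      Hom = (\<lambda>(X, \<psi>F, \<phi>, \<psi>B) (Y, \<psi>F', \<phi>', \<psi>B').
              Hom (Mnd K A F \<mu> \<eta>) (X, \<psi>F) (Y, \<psi>F') \<inter>
              Hom (Comnd K A F \<Delta> \<epsilon>) (X, \<phi>) (Y, \<phi>') \<inter>
              Hom (Mnd K A B \<mu>B \<eta>B) (X, \<psi>B) (Y, \<psi>B')),
      Cmp = vcomp K,
      Idn = (\<lambda>(X, \<psi>F, \<phi>, \<psi>B). id2 K X),
      Tens0 = (\<lambda>((X, \<psi>F, \<phi>, \<psi>B), (Y, \<psi>F', \<phi>', \<psi>B')).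
                (X \<cdot> Y,
                 (X \<rhd> \<psi>F') \<bullet> (\<psi>F \<lhd> Y),
                 (\<phi> \<lhd> Y) \<bullet> (X \<rhd> \<phi>'),
                 (X \<rhd> \<psi>B') \<bullet> (\<psi>B \<lhd> Y))),
      Tens1 = (\<lambda>(\<zeta>, \<xi>). \<zeta> \<star> \<xi>),
      Unit = (id1 K A, id2 K F, id2 K F, id2 K B) \<rparr>"

end

section \<open>Relative modules\<close>

locale left_comodule = comonad +
  fixes M coact
  assumes M_in: "M \<in> Cell1 K" and M_trg: "trg K M = A"
    and coact_in: "coact \<in> hom2 K M (F \<cdot> M)"
    and coact_coassoc: "(\<Delta> \<lhd> M) \<bullet> coact = (F \<rhd> coact) \<bullet> coact"
    and coact_counit: "(\<epsilon> \<lhd> M) \<bullet> coact = id2 K M"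

locale left_module = monad +
  fixes M act
  assumes M_in: "M \<in> Cell1 K" and M_trg: "trg K M = A"
    and act_in: "act \<in> hom2 K (B \<cdot> M) M"
    and act_assoc: "act \<bullet> (\<mu> \<lhd> M) = act \<bullet> (B \<rhd> act)"
    and act_unit: "act \<bullet> (\<eta> \<lhd> M) = id2 K M"

context
  fixes K :: "('o, 'f, 'c) two_category" (structure)
begin

text \<open>
  Objects are \<open>(M, \<delta>M, \<nu>M)\<close> with coaction \<open>\<delta>M : M \<rightarrow> F M\<close> and action \<open>\<nu>M : B M \<rightarrow> M\<close>; the
  source 0-cell of \<open>M\<close> is unrestricted.
\<close>

definition rel_modules ::
    "'o \<Rightarrow> 'f \<Rightarrow> 'c \<Rightarrow> 'c \<Rightarrow> 'f \<Rightarrow> 'c \<Rightarrow> 'c \<Rightarrow> 'c \<Rightarrow> ('f \<times> 'c \<times> 'c, 'c) category"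
  where "rel_modules A F \<Delta> \<epsilon> B \<mu>B \<eta>B \<psi>BF =
    \<lparr> Ob = {(M, \<delta>M, \<nu>M).
              left_comodule K A F \<Delta> \<epsilon> M \<delta>M \<and> left_module K A B \<mu>B \<eta>B M \<nu>M \<and>
              \<delta>M \<bullet> \<nu>M = (F \<rhd> \<nu>M) \<bullet> (\<psi>BF \<lhd> M) \<bullet> (B \<rhd> \<delta>M)},
      Hom = (\<lambda>(M, \<delta>M, \<nu>M) (N, \<delta>N, \<nu>N).
              {f \<in> hom2 K M N. \<delta>N \<bullet> f = (F \<rhd> f) \<bullet> \<delta>M \<and> f \<bullet> \<nu>M = \<nu>N \<bullet> (B \<rhd> f)}),
      Cmp = vcomp K,
      Idn = (\<lambda>(M, \<delta>M, \<nu>M). id2 K M) \<rparr>"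

end

end

theory Submission
  imports Defs
begin

text \<open>
  A left \<open>B\<close>-module \<open>M : A' \<rightarrow> A\<close> is a monad 1-cell (a 1-cell with a distributive law
  \<open>B M \<rightarrow> M I\<close>) from the identity monad on \<open>A'\<close> to \<open>B\<close>, and dually a left \<open>F\<close>-comodule is a
  comonad 1-cell from the identity comonad to \<open>F\<close>.  Likewise the strong Yetter--Drinfel'd
  condition, the second compatibility with \<open>\<psi>BF\<close> and the condition on relative modules are
  instances of one hexagon \<open>(G \<psi>) (\<kappa> X) (C \<phi>) = (\<phi> B) (X \<theta>) (\<psi> F)\<close>.  Hence the tensor
  product and the action are both composition of 1-cells between monads and comonads, and they
  are well defined because (co)monad 1-cells, the hexagons and the corresponding 2-cells are
  closed under pasting.
\<close>

section \<open>Whiskering in a 2-category\<close>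


context two_category
begin

section \<open>Typing of 2-cells and the laws of vertical composition\<close>

lemma id2_cell:
  assumes "f \<in> Cell1 K"
  shows "id2 K f \<in> Cell2 K" "dom2 K (id2 K f) = f" "cod2 K (id2 K f) = f"
  using category.Idn_in_Hom[OF hom_category[OF src_in trg_in], OF assms assms, of f] assms
  by (simp_all add: hom_category_def hom1_def hom2_def)

text \<open>Oriented towards the domain, so that the 0-cells of a 2-cell are always read off
  \<open>dom2\<close>, the form in which the composability premises below are stated.\<close>

lemma src_trg_cod2:
  assumes "\<alpha> \<in> Cell2 K"
  shows "src K (cod2 K \<alpha>) = src K (dom2 K \<alpha>)" "trg K (cod2 K \<alpha>) = trg K (dom2 K \<alpha>)"
  using parallel[OF assms] by simp_all

text \<open>Category laws are available only in a chosen hom-category; here and in the vertical laws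
  below it is the one between the source and target of \<open>dom2 K \<alpha>\<close>.\<close>

lemma vcomp_cell:
  assumes "\<alpha> \<in> Cell2 K" "\<beta> \<in> Cell2 K" "dom2 K \<beta> = cod2 K \<alpha>"
  shows "\<beta> \<bullet> \<alpha> \<in> Cell2 K" "dom2 K (\<beta> \<bullet> \<alpha>) = dom2 K \<alpha>" "cod2 K (\<beta> \<bullet> \<alpha>) = cod2 K \<beta>"
  using category.Cmp_in_Hom[OF hom_category[OF src_in trg_in], OF dom2_in dom2_in,
      OF assms(1,1), of "dom2 K \<alpha>" "cod2 K \<alpha>" "cod2 K \<beta>" \<alpha> \<beta>]
    assms
  by (simp_all add: hom_category_def hom1_def hom2_def dom2_in cod2_in src_trg_cod2)

text \<open>Keeping the equation for \<open>f\<close> as a premise makes this a rewrite rule for an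
  identity on any expression that the simplifier can identify with the codomain. The rules for
  \<open>id1\<close> below are shaped in the same way.\<close>

lemma vcomp_id2_left:
  assumes "\<alpha> \<in> Cell2 K" "cod2 K \<alpha> = f"
  shows "id2 K f \<bullet> \<alpha> = \<alpha>"
  using category.Cmp_Idn_left[OF hom_category[OF src_in trg_in], OF dom2_in dom2_in,
      OF assms(1,1), of "dom2 K \<alpha>" "cod2 K \<alpha>" \<alpha>] assms
  by (auto simp: hom_category_def hom1_def hom2_def dom2_in cod2_in src_trg_cod2)

lemma vcomp_id2_right:
  assumes "\<alpha> \<in> Cell2 K" "dom2 K \<alpha> = f"
  shows "\<alpha> \<bullet> id2 K f = \<alpha>"
  using category.Cmp_Idn_right[OF hom_category[OF src_in trg_in], OF dom2_in dom2_in,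
      OF assms(1,1), of "dom2 K \<alpha>" "cod2 K \<alpha>" \<alpha>] assms
  by (auto simp: hom_category_def hom1_def hom2_def dom2_in cod2_in src_trg_cod2)

lemma vcomp_assoc:
  assumes "\<alpha> \<in> Cell2 K" "\<beta> \<in> Cell2 K" "\<gamma> \<in> Cell2 K"
    "dom2 K \<beta> = cod2 K \<alpha>" "dom2 K \<gamma> = cod2 K \<beta>"
  shows "(\<gamma> \<bullet> \<beta>) \<bullet> \<alpha> = \<gamma> \<bullet> (\<beta> \<bullet> \<alpha>)"
  using category.Cmp_assoc[OF hom_category[OF src_in trg_in], OF dom2_in dom2_in,
      OF assms(1,1), of "dom2 K \<alpha>" "cod2 K \<alpha>" "cod2 K \<beta>" "cod2 K \<gamma>" \<alpha> \<beta> \<gamma>]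
    assms
  by (simp add: hom_category_def hom1_def hom2_def dom2_in cod2_in src_trg_cod2)

section \<open>Horizontal composition, from the composition functor\<close>

lemma comp1_cell:
  assumes "f \<in> Cell1 K" "g \<in> Cell1 K" "src K g = trg K f"
  shows "g \<cdot> f \<in> Cell1 K" "src K (g \<cdot> f) = src K f" "trg K (g \<cdot> f) = trg K g"
  using cat_functor.F0_in_Ob[OF comp_functor[OF src_in trg_in trg_in],
      OF assms(1) assms(1) assms(2), of "(g, f)"] assms
  by (simp_all add: hom_category_def prod_category_def hom1_def)

lemma hcomp_cell:
  assumes "\<alpha> \<in> Cell2 K" "\<beta> \<in> Cell2 K" "src K (dom2 K \<beta>) = trg K (dom2 K \<alpha>)"
  shows "\<beta> \<star> \<alpha> \<in> Cell2 K" "dom2 K (\<beta> \<star> \<alpha>) = dom2 K \<beta> \<cdot> dom2 K \<alpha>"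
    "cod2 K (\<beta> \<star> \<alpha>) = cod2 K \<beta> \<cdot> cod2 K \<alpha>"
  using cat_functor.F1_in_Hom[OF comp_functor[OF src_in trg_in trg_in],
      OF dom2_in dom2_in dom2_in, OF assms(1) assms(1) assms(2),
      of "(dom2 K \<beta>, dom2 K \<alpha>)" "(cod2 K \<beta>, cod2 K \<alpha>)" "(\<beta>, \<alpha>)"]
    assms
  by (simp_all add: hom_category_def prod_category_def hom1_def hom2_def dom2_in cod2_in src_trg_cod2)

lemma hcomp_id2:
  assumes "f \<in> Cell1 K" "g \<in> Cell1 K" "src K g = trg K f"
  shows "id2 K g \<star> id2 K f = id2 K (g \<cdot> f)"
  using cat_functor.F1_Idn[OF comp_functor[OF src_in trg_in trg_in],
      OF assms(1) assms(1) assms(2), of "(g, f)"] assms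
  by (simp add: hom_category_def prod_category_def hom1_def)

text \<open>Horizontal composition is a functor on a product of hom-categories, where vertical
  composition is componentwise.\<close>

lemma interchange:
  assumes "\<alpha> \<in> Cell2 K" "\<alpha>' \<in> Cell2 K" "\<beta> \<in> Cell2 K" "\<beta>' \<in> Cell2 K"
    "dom2 K \<alpha>' = cod2 K \<alpha>" "dom2 K \<beta>' = cod2 K \<beta>" "src K (dom2 K \<beta>) = trg K (dom2 K \<alpha>)"
  shows "(\<beta>' \<star> \<alpha>') \<bullet> (\<beta> \<star> \<alpha>) = (\<beta>' \<bullet> \<beta>) \<star> (\<alpha>' \<bullet> \<alpha>)"
  using cat_functor.F1_Cmp[OF comp_functor[OF src_in trg_in trg_in],
      OF dom2_in dom2_in dom2_in, OF assms(1) assms(1) assms(3),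
      of "(dom2 K \<beta>, dom2 K \<alpha>)" "(cod2 K \<beta>, cod2 K \<alpha>)" "(cod2 K \<beta>', cod2 K \<alpha>')"
        "(\<beta>, \<alpha>)" "(\<beta>', \<alpha>')"]
    assms
  by (simp add: hom_category_def prod_category_def hom1_def hom2_def dom2_in cod2_in src_trg_cod2)

section \<open>Calculus of whiskering\<close>

lemma whisker_left_vcomp:
  assumes "f \<in> Cell1 K" "\<alpha> \<in> Cell2 K" "\<beta> \<in> Cell2 K" "dom2 K \<beta> = cod2 K \<alpha>"
    "src K f = trg K (dom2 K \<alpha>)"
  shows "f \<rhd> (\<beta> \<bullet> \<alpha>) = (f \<rhd> \<beta>) \<bullet> (f \<rhd> \<alpha>)"
  using assms by (simp add: interchange id2_cell vcomp_id2_left)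

lemma whisker_right_vcomp:
  assumes "f \<in> Cell1 K" "\<alpha> \<in> Cell2 K" "\<beta> \<in> Cell2 K" "dom2 K \<beta> = cod2 K \<alpha>"
    "trg K f = src K (dom2 K \<alpha>)"
  shows "(\<beta> \<bullet> \<alpha>) \<lhd> f = (\<beta> \<lhd> f) \<bullet> (\<alpha> \<lhd> f)"
  using assms by (simp add: interchange id2_cell vcomp_id2_left)

text \<open>Nested whiskering on the right is merged by \<open>hcomp_assoc\<close> and
  \<open>hcomp_id2\<close>. On the left the bracketing is already the one that
  \<open>hcomp_assoc\<close> produces, so merging needs its own rule.\<close>

lemma whisker_left_comp1:
  assumes "f \<in> Cell1 K" "g \<in> Cell1 K" "\<alpha> \<in> Cell2 K" "src K g = trg K f" "src K f = trg K (dom2 K \<alpha>)"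
  shows "g \<rhd> (f \<rhd> \<alpha>) = (g \<cdot> f) \<rhd> \<alpha>"
  using assms by (simp add: hcomp_assoc[symmetric] id2_cell hcomp_id2)

text \<open>By \<open>interchange\<close> and the identity laws both sides equal
  \<open>\<beta> \<star> \<alpha>\<close>: cells acting on different factors may be applied in
  either order.\<close>

lemma whisker_exchange:
  assumes "\<alpha> \<in> Cell2 K" "\<beta> \<in> Cell2 K" "dom2 K \<alpha> = g" "cod2 K \<alpha> = g'"
    "dom2 K \<beta> = f" "cod2 K \<beta> = f'" "src K f = trg K g"
  shows "(f' \<rhd> \<alpha>) \<bullet> (\<beta> \<lhd> g) = (\<beta> \<lhd> g') \<bullet> (f \<rhd> \<alpha>)"
  using assms dom2_in[OF assms(1)] dom2_in[OF assms(2)] cod2_in[OF assms(1)] cod2_in[OF assms(2)]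

  by (simp add: interchange id2_cell vcomp_id2_left vcomp_id2_right src_trg_cod2)

lemma whisker_left_id1:
  assumes "\<alpha> \<in> Cell2 K" "trg K (dom2 K \<alpha>) = a"
  shows "id1 K a \<rhd> \<alpha> = \<alpha>"
  using hcomp_id1_left assms by blast

lemma whisker_right_id1:
  assumes "\<alpha> \<in> Cell2 K" "src K (dom2 K \<alpha>) = a"
  shows "\<alpha> \<lhd> id1 K a = \<alpha>"
  using hcomp_id1_right assms by blast

lemma comp1_id1:
  assumes "f \<in> Cell1 K"
  shows "trg K f = a \<Longrightarrow> id1 K a \<cdot> f = f" "src K f = a \<Longrightarrow> f \<cdot> id1 K a = f"
  using comp1_id1_left comp1_id1_right assms by blast+

lemma id1_cell:
  assumes "a \<in> Cell0 K"
  shows "id1 K a \<in> Cell1 K" "src K (id1 K a) = a" "trg K (id1 K a) = a"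
  using id1_in[OF assms] by (simp_all add: hom1_def)

lemmas cells = id2_cell vcomp_cell comp1_cell hcomp_cell id1_cell

text \<open>Rewriting with these rules turns a pasting into a right-bracketed vertical composite of
  whiskered cells. \<open>whisker_exchange\<close> is kept out, so that in the proofs below cells
  pass each other only where this is stated explicitly.\<close>

lemmas whisker_normal = cells comp1_assoc comp1_id1 hcomp_assoc hcomp_id2 vcomp_assoc
  vcomp_id2_left vcomp_id2_right whisker_left_vcomp whisker_right_vcomp whisker_left_comp1
  whisker_left_id1 whisker_right_id1

section \<open>Monad and comonad 1-cells\<close>


lemmas hom_simps = hom1_def hom2_def

text \<open>In contrast to \<open>Mnd\<close>, the two monads may live on different 0-cells, since a
  module has the identity monad of its own source on one side. Only the conditions on
  \<open>X\<close> and \<open>\<psi>\<close> are recorded; the monad laws are separate hypotheses of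
  the lemmas.\<close>

definition monad_cell ::
    "'o \<Rightarrow> 'f \<Rightarrow> 'c \<Rightarrow> 'c \<Rightarrow> 'o \<Rightarrow> 'f \<Rightarrow> 'c \<Rightarrow> 'c \<Rightarrow> 'f \<Rightarrow> 'c \<Rightarrow> bool"
  where "monad_cell a B \<mu> \<eta> b C \<mu>' \<eta>' X \<psi> \<longleftrightarrow>
    X \<in> hom1 K a b \<and> \<psi> \<in> hom2 K (C \<cdot> X) (X \<cdot> B) \<and>
    \<psi> \<bullet> (\<mu>' \<lhd> X) = (X \<rhd> \<mu>) \<bullet> (\<psi> \<lhd> B) \<bullet> (C \<rhd> \<psi>) \<and>
    \<psi> \<bullet> (\<eta>' \<lhd> X) = X \<rhd> \<eta>"

text \<open>The dual of \<open>monad_cell\<close> under reversal of 2-cells, which is why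
  \<open>\<phi>\<close> runs from \<open>X \<cdot> F\<close> to \<open>G \<cdot> X\<close>.\<close>

definition comonad_cell ::
    "'o \<Rightarrow> 'f \<Rightarrow> 'c \<Rightarrow> 'c \<Rightarrow> 'o \<Rightarrow> 'f \<Rightarrow> 'c \<Rightarrow> 'c \<Rightarrow> 'f \<Rightarrow> 'c \<Rightarrow> bool"
  where "comonad_cell a F \<Delta> \<epsilon> b G \<Delta>' \<epsilon>' X \<phi> \<longleftrightarrow>
    X \<in> hom1 K a b \<and> \<phi> \<in> hom2 K (X \<cdot> F) (G \<cdot> X) \<and>
    (\<Delta>' \<lhd> X) \<bullet> \<phi> = (G \<rhd> \<phi>) \<bullet> (\<phi> \<lhd> F) \<bullet> (X \<rhd> \<Delta>) \<and>
    (\<epsilon>' \<lhd> X) \<bullet> \<phi> = X \<rhd> \<epsilon>"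

text \<open>
  \<open>C = G = F\<close> with \<open>\<kappa> = \<theta> = lam\<close> gives the Yetter--Drinfel'd condition; \<open>B\<close>, \<open>F\<close> and \<open>\<theta>\<close>
  identities give the condition on relative modules.
\<close>

definition mixed_compatible ::
    "'f \<Rightarrow> 'f \<Rightarrow> 'c \<Rightarrow> 'f \<Rightarrow> 'f \<Rightarrow> 'c \<Rightarrow> 'f \<Rightarrow> 'c \<Rightarrow> 'c \<Rightarrow> bool"
  where "mixed_compatible B F \<theta> C G \<kappa> X \<psi> \<phi> \<longleftrightarrow>
    (G \<rhd> \<psi>) \<bullet> (\<kappa> \<lhd> X) \<bullet> (C \<rhd> \<phi>) = (\<phi> \<lhd> B) \<bullet> (X \<rhd> \<theta>) \<bullet> (\<psi> \<lhd> F)"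

text \<open>The Yang-Baxter hexagon for two structure cells of the same direction: two routes from
  \<open>C \<cdot> G \<cdot> X\<close> to \<open>X \<cdot> F \<cdot> B\<close>. It covers the
  compatibility of \<open>\<psi>B\<close> with \<open>\<psi>F\<close>.\<close>

definition yang_baxter ::
    "'f \<Rightarrow> 'f \<Rightarrow> 'c \<Rightarrow> 'f \<Rightarrow> 'f \<Rightarrow> 'c \<Rightarrow> 'f \<Rightarrow> 'c \<Rightarrow> 'c \<Rightarrow> bool"
  where "yang_baxter B F \<theta> C G \<kappa> X \<psi> \<chi> \<longleftrightarrow>
    (X \<rhd> \<theta>) \<bullet> (\<psi> \<lhd> F) \<bullet> (C \<rhd> \<chi>) = (\<chi> \<lhd> B) \<bullet> (G \<rhd> \<psi>) \<bullet> (\<kappa> \<lhd> X)"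

definition monad_2cell :: "'f \<Rightarrow> 'f \<Rightarrow> 'f \<Rightarrow> 'c \<Rightarrow> 'f \<Rightarrow> 'c \<Rightarrow> 'c \<Rightarrow> bool"
  where "monad_2cell B C X \<psi> X' \<psi>' \<zeta> \<longleftrightarrow>
    \<zeta> \<in> hom2 K X X' \<and> (\<zeta> \<lhd> B) \<bullet> \<psi> = \<psi>' \<bullet> (C \<rhd> \<zeta>)"

definition comonad_2cell :: "'f \<Rightarrow> 'f \<Rightarrow> 'f \<Rightarrow> 'c \<Rightarrow> 'f \<Rightarrow> 'c \<Rightarrow> 'c \<Rightarrow> bool"
  where "comonad_2cell F G X \<phi> X' \<phi>' \<zeta> \<longleftrightarrow>
    \<zeta> \<in> hom2 K X X' \<and> (G \<rhd> \<zeta>) \<bullet> \<phi> = \<phi>' \<bullet> (\<zeta> \<lhd> F)"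

section \<open>Closure of 1-cells and hexagons under composition\<close>

lemma monad_cell_comp:
  assumes B: "monad K a B \<mu> \<eta>" and C: "monad K b C \<mu>' \<eta>'" and D: "monad K c D \<mu>'' \<eta>''"
    and X: "monad_cell b C \<mu>' \<eta>' c D \<mu>'' \<eta>'' X p"
    and Y: "monad_cell a B \<mu> \<eta> b C \<mu>' \<eta>' Y q"
  shows "monad_cell a B \<mu> \<eta> c D \<mu>'' \<eta>'' (X \<cdot> Y) ((X \<rhd> q) \<bullet> (p \<lhd> Y))"
proof -
  \<comment> \<open>The rules in \<open>whisker_normal\<close> have typing premises, so all typing
    facts are handed to the simplifier at the outset.\<close>
  note [simp] = monad.monad_base[OF B] monad.monad_base[OF C] monad.monad_base[OF D]
  note [simp] = monad.monad_carrier[OF B, unfolded hom_simps, simplified]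
    monad.mult[OF B, unfolded hom_simps, simplified] monad.unit[OF B, unfolded hom_simps, simplified]
    monad.monad_carrier[OF C, unfolded hom_simps, simplified]
    monad.mult[OF C, unfolded hom_simps, simplified] monad.unit[OF C, unfolded hom_simps, simplified]
    monad.monad_carrier[OF D, unfolded hom_simps, simplified]
    monad.mult[OF D, unfolded hom_simps, simplified] monad.unit[OF D, unfolded hom_simps, simplified]
  have [simp]: "X \<in> Cell1 K" "src K X = b" "trg K X = c" "p \<in> Cell2 K" "dom2 K p = D \<cdot> X" "cod2 K p = X \<cdot> C"
    and X_mult: "p \<bullet> (\<mu>'' \<lhd> X) = (X \<rhd> \<mu>') \<bullet> (p \<lhd> C) \<bullet> (D \<rhd> p)" and X_unit: "p \<bullet> (\<eta>'' \<lhd> X) = X \<rhd> \<eta>'"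
    using X by (simp_all add: monad_cell_def hom_simps)
  have [simp]: "Y \<in> Cell1 K" "src K Y = a" "trg K Y = b" "q \<in> Cell2 K" "dom2 K q = C \<cdot> Y" "cod2 K q = Y \<cdot> B"
    and Y_mult: "q \<bullet> (\<mu>' \<lhd> Y) = (Y \<rhd> \<mu>) \<bullet> (q \<lhd> B) \<bullet> (C \<rhd> q)" and Y_unit: "q \<bullet> (\<eta>' \<lhd> Y) = Y \<rhd> \<eta>"
    using Y by (simp_all add: monad_cell_def hom_simps)
  have "((X \<rhd> q) \<bullet> (p \<lhd> Y)) \<bullet> (\<mu>'' \<lhd> (X \<cdot> Y)) = (X \<rhd> q) \<bullet> ((p \<bullet> (\<mu>'' \<lhd> X)) \<lhd> Y)"
    by (simp add: whisker_normal)
  also have "\<dots> = (X \<rhd> q) \<bullet> (((X \<rhd> \<mu>') \<bullet> (p \<lhd> C) \<bullet> (D \<rhd> p)) \<lhd> Y)"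
    by (simp only: X_mult)
  also have "\<dots> = (X \<rhd> (q \<bullet> (\<mu>' \<lhd> Y))) \<bullet> (p \<lhd> (C \<cdot> Y)) \<bullet> ((D \<rhd> p) \<lhd> Y)"
    by (simp add: whisker_normal)
  also have "\<dots> = (X \<rhd> ((Y \<rhd> \<mu>) \<bullet> (q \<lhd> B) \<bullet> (C \<rhd> q))) \<bullet> (p \<lhd> (C \<cdot> Y)) \<bullet> ((D \<rhd> p) \<lhd> Y)"
    by (simp only: Y_mult)
  also have "\<dots> = ((X \<cdot> Y) \<rhd> \<mu>) \<bullet> (X \<rhd> (q \<lhd> B)) \<bullet>
      (((X \<cdot> C) \<rhd> q) \<bullet> (p \<lhd> (C \<cdot> Y))) \<bullet> ((D \<rhd> p) \<lhd> Y)"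
    by (simp add: whisker_normal)
  \<comment> \<open>The later copy of \<open>p\<close> acts left of the factors on which the earlier
    copy of \<open>q\<close> acts, so the two commute; this interleaves them into two whole copies
    of the composite cell.\<close>
  also have "((X \<cdot> C) \<rhd> q) \<bullet> (p \<lhd> (C \<cdot> Y)) = (p \<lhd> (Y \<cdot> B)) \<bullet> ((D \<cdot> X) \<rhd> q)"
    by (rule whisker_exchange) (simp_all add: cells)
  finally have mult: "((X \<rhd> q) \<bullet> (p \<lhd> Y)) \<bullet> (\<mu>'' \<lhd> (X \<cdot> Y)) =
      ((X \<cdot> Y) \<rhd> \<mu>) \<bullet> (((X \<rhd> q) \<bullet> (p \<lhd> Y)) \<lhd> B) \<bullet> (D \<rhd> ((X \<rhd> q) \<bullet> (p \<lhd> Y)))"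
    by (simp add: whisker_normal)
  have "((X \<rhd> q) \<bullet> (p \<lhd> Y)) \<bullet> (\<eta>'' \<lhd> (X \<cdot> Y)) = (X \<rhd> q) \<bullet> ((p \<bullet> (\<eta>'' \<lhd> X)) \<lhd> Y)"
    by (simp add: whisker_normal)
  also have "\<dots> = X \<rhd> (q \<bullet> (\<eta>' \<lhd> Y))"
    by (simp add: X_unit whisker_normal)
  also have "\<dots> = (X \<cdot> Y) \<rhd> \<eta>"
    by (simp only: Y_unit) (simp add: whisker_normal)
  finally show ?thesis
    using mult by (simp add: monad_cell_def hom_simps whisker_normal)
qed

text \<open>The argument for monads with all vertical composites reversed: the comultiplication
  passes \<open>X\<close> by the law of \<open>p\<close>, then \<open>Y\<close> by the law of
  \<open>q\<close>.\<close>

lemma comonad_cell_comp: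
  assumes F: "comonad K a F \<Delta> \<epsilon>" and G: "comonad K b G \<Delta>' \<epsilon>'" and H: "comonad K c H \<Delta>'' \<epsilon>''"
    and X: "comonad_cell b G \<Delta>' \<epsilon>' c H \<Delta>'' \<epsilon>'' X p"
    and Y: "comonad_cell a F \<Delta> \<epsilon> b G \<Delta>' \<epsilon>' Y q"
  shows "comonad_cell a F \<Delta> \<epsilon> c H \<Delta>'' \<epsilon>'' (X \<cdot> Y) ((p \<lhd> Y) \<bullet> (X \<rhd> q))"
proof -
  note [simp] = comonad.comonad_base[OF F] comonad.comonad_base[OF G] comonad.comonad_base[OF H]
  note [simp] = comonad.comonad_carrier[OF F, unfolded hom_simps, simplified]
    comonad.comult[OF F, unfolded hom_simps, simplified] comonad.counit[OF F, unfolded hom_simps, simplified]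
    comonad.comonad_carrier[OF G, unfolded hom_simps, simplified]
    comonad.comult[OF G, unfolded hom_simps, simplified] comonad.counit[OF G, unfolded hom_simps, simplified]
    comonad.comonad_carrier[OF H, unfolded hom_simps, simplified]
    comonad.comult[OF H, unfolded hom_simps, simplified] comonad.counit[OF H, unfolded hom_simps, simplified]
  have [simp]: "X \<in> Cell1 K" "src K X = b" "trg K X = c" "p \<in> Cell2 K" "dom2 K p = X \<cdot> G" "cod2 K p = H \<cdot> X"
    and X_comult: "(\<Delta>'' \<lhd> X) \<bullet> p = (H \<rhd> p) \<bullet> (p \<lhd> G) \<bullet> (X \<rhd> \<Delta>')" and X_counit: "(\<epsilon>'' \<lhd> X) \<bullet> p = X \<rhd> \<epsilon>'"
    using X by (simp_all add: comonad_cell_def hom_simps)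
  have [simp]: "Y \<in> Cell1 K" "src K Y = a" "trg K Y = b" "q \<in> Cell2 K" "dom2 K q = Y \<cdot> F" "cod2 K q = G \<cdot> Y"
    and Y_comult: "(\<Delta>' \<lhd> Y) \<bullet> q = (G \<rhd> q) \<bullet> (q \<lhd> F) \<bullet> (Y \<rhd> \<Delta>)" and Y_counit: "(\<epsilon>' \<lhd> Y) \<bullet> q = Y \<rhd> \<epsilon>"
    using Y by (simp_all add: comonad_cell_def hom_simps)
  have "(\<Delta>'' \<lhd> (X \<cdot> Y)) \<bullet> ((p \<lhd> Y) \<bullet> (X \<rhd> q)) = (((\<Delta>'' \<lhd> X) \<bullet> p) \<lhd> Y) \<bullet> (X \<rhd> q)"
    by (simp add: whisker_normal)
  also have "\<dots> = (((H \<rhd> p) \<bullet> (p \<lhd> G) \<bullet> (X \<rhd> \<Delta>')) \<lhd> Y) \<bullet> (X \<rhd> q)"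
    by (simp only: X_comult)
  also have "\<dots> = ((H \<rhd> p) \<lhd> Y) \<bullet> (p \<lhd> (G \<cdot> Y)) \<bullet> (X \<rhd> ((\<Delta>' \<lhd> Y) \<bullet> q))"
    by (simp add: whisker_normal)
  also have "\<dots> = ((H \<rhd> p) \<lhd> Y) \<bullet> (p \<lhd> (G \<cdot> Y)) \<bullet> (X \<rhd> ((G \<rhd> q) \<bullet> (q \<lhd> F) \<bullet> (Y \<rhd> \<Delta>)))"
    by (simp only: Y_comult)
  also have "\<dots> = ((H \<rhd> p) \<lhd> Y) \<bullet> ((p \<lhd> (G \<cdot> Y)) \<bullet> ((X \<cdot> G) \<rhd> q)) \<bullet> (X \<rhd> (q \<lhd> F)) \<bullet> ((X \<cdot> Y) \<rhd> \<Delta>)"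
    by (simp add: whisker_normal)
  also have "(p \<lhd> (G \<cdot> Y)) \<bullet> ((X \<cdot> G) \<rhd> q) = ((H \<cdot> X) \<rhd> q) \<bullet> (p \<lhd> (Y \<cdot> F))"
    by (rule whisker_exchange[symmetric]) (simp_all add: cells)
  finally have comult: "(\<Delta>'' \<lhd> (X \<cdot> Y)) \<bullet> ((p \<lhd> Y) \<bullet> (X \<rhd> q)) =
      (H \<rhd> ((p \<lhd> Y) \<bullet> (X \<rhd> q))) \<bullet> (((p \<lhd> Y) \<bullet> (X \<rhd> q)) \<lhd> F) \<bullet> ((X \<cdot> Y) \<rhd> \<Delta>)"
    by (simp add: whisker_normal)
  have "(\<epsilon>'' \<lhd> (X \<cdot> Y)) \<bullet> ((p \<lhd> Y) \<bullet> (X \<rhd> q)) = (((\<epsilon>'' \<lhd> X) \<bullet> p) \<lhd> Y) \<bullet> (X \<rhd> q)"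
    by (simp add: whisker_normal)
  also have "\<dots> = X \<rhd> ((\<epsilon>' \<lhd> Y) \<bullet> q)"
    by (simp add: X_counit whisker_normal)
  also have "\<dots> = (X \<cdot> Y) \<rhd> \<epsilon>"
    by (simp only: Y_counit) (simp add: whisker_normal)
  finally show ?thesis
    using comult by (simp add: comonad_cell_def hom_simps whisker_normal)
qed

text \<open>The hexagon of \<open>X\<close>, whiskered by \<open>Y\<close>, and that of
  \<open>Y\<close>, whiskered by \<open>X\<close>, share the cell \<open>\<kappa>\<close>. Pasting
  them along it gives the hexagon of the composite.\<close>

lemma mixed_compatible_comp:
  assumes BF: "B \<in> hom1 K a a" "F \<in> hom1 K a a" "\<theta> \<in> hom2 K (B \<cdot> F) (F \<cdot> B)"
    and CG: "C \<in> hom1 K b b" "G \<in> hom1 K b b" "\<kappa> \<in> hom2 K (C \<cdot> G) (G \<cdot> C)"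
    and DH: "D \<in> hom1 K c c" "H \<in> hom1 K c c" "\<tau> \<in> hom2 K (D \<cdot> H) (H \<cdot> D)"
    and X: "X \<in> hom1 K b c" "p \<in> hom2 K (D \<cdot> X) (X \<cdot> C)" "f \<in> hom2 K (X \<cdot> G) (H \<cdot> X)"
    and Y: "Y \<in> hom1 K a b" "q \<in> hom2 K (C \<cdot> Y) (Y \<cdot> B)" "g \<in> hom2 K (Y \<cdot> F) (G \<cdot> Y)"
    and X_comp: "mixed_compatible C G \<kappa> D H \<tau> X p f"
    and Y_comp: "mixed_compatible B F \<theta> C G \<kappa> Y q g"
  shows "mixed_compatible B F \<theta> D H \<tau> (X \<cdot> Y) ((X \<rhd> q) \<bullet> (p \<lhd> Y)) ((f \<lhd> Y) \<bullet> (X \<rhd> g))"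
proof -
  note [simp] = BF[unfolded hom_simps, simplified] CG[unfolded hom_simps, simplified]
    DH[unfolded hom_simps, simplified] X[unfolded hom_simps, simplified] Y[unfolded hom_simps, simplified]
  have "(H \<rhd> ((X \<rhd> q) \<bullet> (p \<lhd> Y))) \<bullet> (\<tau> \<lhd> (X \<cdot> Y)) \<bullet> (D \<rhd> ((f \<lhd> Y) \<bullet> (X \<rhd> g))) =
      ((H \<cdot> X) \<rhd> q) \<bullet> (((H \<rhd> p) \<bullet> (\<tau> \<lhd> X) \<bullet> (D \<rhd> f)) \<lhd> Y) \<bullet> ((D \<cdot> X) \<rhd> g)"
    by (simp add: whisker_normal)
  also have "\<dots> = ((H \<cdot> X) \<rhd> q) \<bullet> (((f \<lhd> C) \<bullet> (X \<rhd> \<kappa>) \<bullet> (p \<lhd> G)) \<lhd> Y) \<bullet> ((D \<cdot> X) \<rhd> g)"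
    by (simp only: X_comp[unfolded mixed_compatible_def])
  also have "\<dots> = (((H \<cdot> X) \<rhd> q) \<bullet> (f \<lhd> (C \<cdot> Y))) \<bullet> (X \<rhd> (\<kappa> \<lhd> Y)) \<bullet>
      ((p \<lhd> (G \<cdot> Y)) \<bullet> ((D \<cdot> X) \<rhd> g))"
    by (simp add: whisker_normal)
  \<comment> \<open>Moving \<open>q\<close> past \<open>f\<close> and \<open>g\<close> past
    \<open>p\<close> brings \<open>q\<close> and \<open>g\<close> next to \<open>\<kappa>\<close>,
    where they form one side of the hexagon of \<open>Y\<close>.\<close>
  also have "((H \<cdot> X) \<rhd> q) \<bullet> (f \<lhd> (C \<cdot> Y)) = (f \<lhd> (Y \<cdot> B)) \<bullet> ((X \<cdot> G) \<rhd> q)"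
    by (rule whisker_exchange) (simp_all add: cells)
  also have "(p \<lhd> (G \<cdot> Y)) \<bullet> ((D \<cdot> X) \<rhd> g) = ((X \<cdot> C) \<rhd> g) \<bullet> (p \<lhd> (Y \<cdot> F))"
    by (rule whisker_exchange[symmetric]) (simp_all add: cells)
  also have "((f \<lhd> (Y \<cdot> B)) \<bullet> ((X \<cdot> G) \<rhd> q)) \<bullet> (X \<rhd> (\<kappa> \<lhd> Y)) \<bullet> (((X \<cdot> C) \<rhd> g) \<bullet> (p \<lhd> (Y \<cdot> F))) =
      (f \<lhd> (Y \<cdot> B)) \<bullet> (X \<rhd> ((G \<rhd> q) \<bullet> (\<kappa> \<lhd> Y) \<bullet> (C \<rhd> g))) \<bullet> (p \<lhd> (Y \<cdot> F))"
    by (simp add: whisker_normal)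
  also have "\<dots> = (f \<lhd> (Y \<cdot> B)) \<bullet> (X \<rhd> ((g \<lhd> B) \<bullet> (Y \<rhd> \<theta>) \<bullet> (q \<lhd> F))) \<bullet> (p \<lhd> (Y \<cdot> F))"
    by (simp only: Y_comp[unfolded mixed_compatible_def])
  finally show ?thesis
    by (simp add: mixed_compatible_def whisker_normal)
qed

text \<open>Again a pasting along \<open>\<kappa>\<close>, now starting with the hexagon of
  \<open>Y\<close>. The exchanges take place before the first hexagon and after the second.\<close>

lemma yang_baxter_comp:
  assumes BF: "B \<in> hom1 K a a" "F \<in> hom1 K a a" "\<theta> \<in> hom2 K (B \<cdot> F) (F \<cdot> B)"
    and CG: "C \<in> hom1 K b b" "G \<in> hom1 K b b" "\<kappa> \<in> hom2 K (C \<cdot> G) (G \<cdot> C)"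
    and DH: "D \<in> hom1 K c c" "H \<in> hom1 K c c" "\<tau> \<in> hom2 K (D \<cdot> H) (H \<cdot> D)"
    and X: "X \<in> hom1 K b c" "p \<in> hom2 K (D \<cdot> X) (X \<cdot> C)" "f \<in> hom2 K (H \<cdot> X) (X \<cdot> G)"
    and Y: "Y \<in> hom1 K a b" "q \<in> hom2 K (C \<cdot> Y) (Y \<cdot> B)" "g \<in> hom2 K (G \<cdot> Y) (Y \<cdot> F)"
    and X_yb: "yang_baxter C G \<kappa> D H \<tau> X p f"
    and Y_yb: "yang_baxter B F \<theta> C G \<kappa> Y q g"
  shows "yang_baxter B F \<theta> D H \<tau> (X \<cdot> Y) ((X \<rhd> q) \<bullet> (p \<lhd> Y)) ((X \<rhd> g) \<bullet> (f \<lhd> Y))"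
proof -
  note [simp] = BF[unfolded hom_simps, simplified] CG[unfolded hom_simps, simplified]
    DH[unfolded hom_simps, simplified] X[unfolded hom_simps, simplified] Y[unfolded hom_simps, simplified]
  have "((X \<cdot> Y) \<rhd> \<theta>) \<bullet> (((X \<rhd> q) \<bullet> (p \<lhd> Y)) \<lhd> F) \<bullet> (D \<rhd> ((X \<rhd> g) \<bullet> (f \<lhd> Y))) =
      ((X \<cdot> Y) \<rhd> \<theta>) \<bullet> (X \<rhd> (q \<lhd> F)) \<bullet> ((p \<lhd> (Y \<cdot> F)) \<bullet> ((D \<cdot> X) \<rhd> g)) \<bullet> (D \<rhd> (f \<lhd> Y))"
    by (simp add: whisker_normal)
  also have "(p \<lhd> (Y \<cdot> F)) \<bullet> ((D \<cdot> X) \<rhd> g) = ((X \<cdot> C) \<rhd> g) \<bullet> (p \<lhd> (G \<cdot> Y))"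
    by (rule whisker_exchange[symmetric]) (simp_all add: cells)
  also have "((X \<cdot> Y) \<rhd> \<theta>) \<bullet> (X \<rhd> (q \<lhd> F)) \<bullet> (((X \<cdot> C) \<rhd> g) \<bullet> (p \<lhd> (G \<cdot> Y))) \<bullet> (D \<rhd> (f \<lhd> Y)) =
      (X \<rhd> ((Y \<rhd> \<theta>) \<bullet> (q \<lhd> F) \<bullet> (C \<rhd> g))) \<bullet> (p \<lhd> (G \<cdot> Y)) \<bullet> (D \<rhd> (f \<lhd> Y))"
    by (simp add: whisker_normal)
  also have "\<dots> = (X \<rhd> ((g \<lhd> B) \<bullet> (G \<rhd> q) \<bullet> (\<kappa> \<lhd> Y))) \<bullet> (p \<lhd> (G \<cdot> Y)) \<bullet> (D \<rhd> (f \<lhd> Y))"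
    by (simp only: Y_yb[unfolded yang_baxter_def])
  also have "\<dots> = (X \<rhd> (g \<lhd> B)) \<bullet> ((X \<cdot> G) \<rhd> q) \<bullet> (((X \<rhd> \<kappa>) \<bullet> (p \<lhd> G) \<bullet> (D \<rhd> f)) \<lhd> Y)"
    by (simp add: whisker_normal)
  also have "\<dots> = (X \<rhd> (g \<lhd> B)) \<bullet> ((X \<cdot> G) \<rhd> q) \<bullet> (((f \<lhd> C) \<bullet> (H \<rhd> p) \<bullet> (\<tau> \<lhd> X)) \<lhd> Y)"
    by (simp only: X_yb[unfolded yang_baxter_def])
  also have "\<dots> = (X \<rhd> (g \<lhd> B)) \<bullet> (((X \<cdot> G) \<rhd> q) \<bullet> (f \<lhd> (C \<cdot> Y))) \<bullet> (H \<rhd> (p \<lhd> Y)) \<bullet> (\<tau> \<lhd> (X \<cdot> Y))"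
    by (simp add: whisker_normal)
  also have "((X \<cdot> G) \<rhd> q) \<bullet> (f \<lhd> (C \<cdot> Y)) = (f \<lhd> (Y \<cdot> B)) \<bullet> ((H \<cdot> X) \<rhd> q)"
    by (rule whisker_exchange) (simp_all add: cells)
  finally show ?thesis
    by (simp add: yang_baxter_def whisker_normal)
qed

section \<open>Closure of the 2-cells under both compositions\<close>

lemma monad_2cell_hcomp:
  assumes BCD: "B \<in> hom1 K a a" "C \<in> hom1 K b b" "D \<in> hom1 K c c"
    and X: "X \<in> hom1 K b c" "p \<in> hom2 K (D \<cdot> X) (X \<cdot> C)"
    and X': "X' \<in> hom1 K b c" "p' \<in> hom2 K (D \<cdot> X') (X' \<cdot> C)"
    and Y: "Y \<in> hom1 K a b" "q \<in> hom2 K (C \<cdot> Y) (Y \<cdot> B)"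
    and Y': "Y' \<in> hom1 K a b" "q' \<in> hom2 K (C \<cdot> Y') (Y' \<cdot> B)"
    and \<zeta>: "monad_2cell C D X p X' p' \<zeta>" and \<xi>: "monad_2cell B C Y q Y' q' \<xi>"
  shows "monad_2cell B D (X \<cdot> Y) ((X \<rhd> q) \<bullet> (p \<lhd> Y)) (X' \<cdot> Y') ((X' \<rhd> q') \<bullet> (p' \<lhd> Y')) (\<zeta> \<star> \<xi>)"
proof -
  note [simp] = BCD[unfolded hom_simps, simplified] X[unfolded hom_simps, simplified]
    X'[unfolded hom_simps, simplified] Y[unfolded hom_simps, simplified] Y'[unfolded hom_simps, simplified]
  have [simp]: "\<zeta> \<in> Cell2 K" "dom2 K \<zeta> = X" "cod2 K \<zeta> = X'" and \<zeta>_nat: "(\<zeta> \<lhd> C) \<bullet> p = p' \<bullet> (D \<rhd> \<zeta>)"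
    using \<zeta> by (simp_all add: monad_2cell_def hom_simps)
  have [simp]: "\<xi> \<in> Cell2 K" "dom2 K \<xi> = Y" "cod2 K \<xi> = Y'" and \<xi>_nat: "(\<xi> \<lhd> B) \<bullet> q = q' \<bullet> (C \<rhd> \<xi>)"
    using \<xi> by (simp_all add: monad_2cell_def hom_simps)
  \<comment> \<open>Of the two factorisations, this one places \<open>\<xi>\<close> directly after
    \<open>q\<close>, so that its naturality applies at once.\<close>
  have split: "\<zeta> \<star> \<xi> = (\<zeta> \<lhd> Y') \<bullet> (X \<rhd> \<xi>)"
    by (simp add: interchange vcomp_id2_left vcomp_id2_right cells)
  have "((\<zeta> \<star> \<xi>) \<lhd> B) \<bullet> ((X \<rhd> q) \<bullet> (p \<lhd> Y)) =
      (\<zeta> \<lhd> (Y' \<cdot> B)) \<bullet> (X \<rhd> ((\<xi> \<lhd> B) \<bullet> q)) \<bullet> (p \<lhd> Y)"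
    unfolding split by (simp add: whisker_normal)
  also have "\<dots> = (\<zeta> \<lhd> (Y' \<cdot> B)) \<bullet> (X \<rhd> (q' \<bullet> (C \<rhd> \<xi>))) \<bullet> (p \<lhd> Y)"
    by (simp only: \<xi>_nat)
  also have "\<dots> = ((\<zeta> \<lhd> (Y' \<cdot> B)) \<bullet> (X \<rhd> q')) \<bullet> (((X \<cdot> C) \<rhd> \<xi>) \<bullet> (p \<lhd> Y))"
    by (simp add: whisker_normal)
  also have "((X \<cdot> C) \<rhd> \<xi>) \<bullet> (p \<lhd> Y) = (p \<lhd> Y') \<bullet> ((D \<cdot> X) \<rhd> \<xi>)"
    by (rule whisker_exchange) (simp_all add: cells)
  also have "(\<zeta> \<lhd> (Y' \<cdot> B)) \<bullet> (X \<rhd> q') = (X' \<rhd> q') \<bullet> (\<zeta> \<lhd> (C \<cdot> Y'))"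
    by (rule whisker_exchange[symmetric]) (simp_all add: cells)
  also have "((X' \<rhd> q') \<bullet> (\<zeta> \<lhd> (C \<cdot> Y'))) \<bullet> ((p \<lhd> Y') \<bullet> ((D \<cdot> X) \<rhd> \<xi>)) =
      (X' \<rhd> q') \<bullet> (((\<zeta> \<lhd> C) \<bullet> p) \<lhd> Y') \<bullet> ((D \<cdot> X) \<rhd> \<xi>)"
    by (simp add: whisker_normal)
  also have "\<dots> = (X' \<rhd> q') \<bullet> ((p' \<bullet> (D \<rhd> \<zeta>)) \<lhd> Y') \<bullet> ((D \<cdot> X) \<rhd> \<xi>)"
    by (simp only: \<zeta>_nat)
  also have "\<dots> = ((X' \<rhd> q') \<bullet> (p' \<lhd> Y')) \<bullet> (D \<rhd> (\<zeta> \<star> \<xi>))"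
    unfolding split by (simp add: whisker_normal)
  finally show ?thesis
    by (simp add: monad_2cell_def hom_simps cells)
qed

lemma comonad_2cell_hcomp:
  assumes FGH: "F \<in> hom1 K a a" "G \<in> hom1 K b b" "H \<in> hom1 K c c"
    and X: "X \<in> hom1 K b c" "p \<in> hom2 K (X \<cdot> G) (H \<cdot> X)"
    and X': "X' \<in> hom1 K b c" "p' \<in> hom2 K (X' \<cdot> G) (H \<cdot> X')"
    and Y: "Y \<in> hom1 K a b" "q \<in> hom2 K (Y \<cdot> F) (G \<cdot> Y)"
    and Y': "Y' \<in> hom1 K a b" "q' \<in> hom2 K (Y' \<cdot> F) (G \<cdot> Y')"
    and \<zeta>: "comonad_2cell G H X p X' p' \<zeta>" and \<xi>: "comonad_2cell F G Y q Y' q' \<xi>"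
  shows "comonad_2cell F H (X \<cdot> Y) ((p \<lhd> Y) \<bullet> (X \<rhd> q)) (X' \<cdot> Y') ((p' \<lhd> Y') \<bullet> (X' \<rhd> q')) (\<zeta> \<star> \<xi>)"
proof -
  note [simp] = FGH[unfolded hom_simps, simplified] X[unfolded hom_simps, simplified]
    X'[unfolded hom_simps, simplified] Y[unfolded hom_simps, simplified] Y'[unfolded hom_simps, simplified]
  have [simp]: "\<zeta> \<in> Cell2 K" "dom2 K \<zeta> = X" "cod2 K \<zeta> = X'" and \<zeta>_nat: "(H \<rhd> \<zeta>) \<bullet> p = p' \<bullet> (\<zeta> \<lhd> G)"
    using \<zeta> by (simp_all add: comonad_2cell_def hom_simps)
  have [simp]: "\<xi> \<in> Cell2 K" "dom2 K \<xi> = Y" "cod2 K \<xi> = Y'" and \<xi>_nat: "(G \<rhd> \<xi>) \<bullet> q = q' \<bullet> (\<xi> \<lhd> F)"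
    using \<xi> by (simp_all add: comonad_2cell_def hom_simps)
  \<comment> \<open>Here \<open>p\<close> is applied last in the structure cell, so the
    factorisation with \<open>\<zeta>\<close> first is the one that fits.\<close>
  have split: "\<zeta> \<star> \<xi> = (X' \<rhd> \<xi>) \<bullet> (\<zeta> \<lhd> Y)"
    by (simp add: interchange vcomp_id2_left vcomp_id2_right cells)
  have "(H \<rhd> (\<zeta> \<star> \<xi>)) \<bullet> ((p \<lhd> Y) \<bullet> (X \<rhd> q)) =
      ((H \<cdot> X') \<rhd> \<xi>) \<bullet> (((H \<rhd> \<zeta>) \<bullet> p) \<lhd> Y) \<bullet> (X \<rhd> q)"
    unfolding split by (simp add: whisker_normal)
  also have "\<dots> = ((H \<cdot> X') \<rhd> \<xi>) \<bullet> ((p' \<bullet> (\<zeta> \<lhd> G)) \<lhd> Y) \<bullet> (X \<rhd> q)"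
    by (simp only: \<zeta>_nat)
  also have "\<dots> = (((H \<cdot> X') \<rhd> \<xi>) \<bullet> (p' \<lhd> Y)) \<bullet> ((\<zeta> \<lhd> (G \<cdot> Y)) \<bullet> (X \<rhd> q))"
    by (simp add: whisker_normal)
  also have "((H \<cdot> X') \<rhd> \<xi>) \<bullet> (p' \<lhd> Y) = (p' \<lhd> Y') \<bullet> ((X' \<cdot> G) \<rhd> \<xi>)"
    by (rule whisker_exchange) (simp_all add: cells)
  also have "(\<zeta> \<lhd> (G \<cdot> Y)) \<bullet> (X \<rhd> q) = (X' \<rhd> q) \<bullet> (\<zeta> \<lhd> (Y \<cdot> F))"
    by (rule whisker_exchange[symmetric]) (simp_all add: cells)
  also have "((p' \<lhd> Y') \<bullet> ((X' \<cdot> G) \<rhd> \<xi>)) \<bullet> ((X' \<rhd> q) \<bullet> (\<zeta> \<lhd> (Y \<cdot> F))) =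
      (p' \<lhd> Y') \<bullet> (X' \<rhd> ((G \<rhd> \<xi>) \<bullet> q)) \<bullet> (\<zeta> \<lhd> (Y \<cdot> F))"
    by (simp add: whisker_normal)
  also have "\<dots> = (p' \<lhd> Y') \<bullet> (X' \<rhd> (q' \<bullet> (\<xi> \<lhd> F))) \<bullet> (\<zeta> \<lhd> (Y \<cdot> F))"
    by (simp only: \<xi>_nat)
  also have "\<dots> = ((p' \<lhd> Y') \<bullet> (X' \<rhd> q')) \<bullet> ((\<zeta> \<star> \<xi>) \<lhd> F)"
    unfolding split by (simp add: whisker_normal)
  finally show ?thesis
    by (simp add: comonad_2cell_def hom_simps cells)
qed

lemma monad_2cell_id2:
  assumes "B \<in> hom1 K a a" "C \<in> hom1 K b b" "X \<in> hom1 K a b" "p \<in> hom2 K (C \<cdot> X) (X \<cdot> B)"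
  shows "monad_2cell B C X p X p (id2 K X)"
  using assms by (simp add: monad_2cell_def hom_simps whisker_normal)

lemma comonad_2cell_id2:
  assumes "F \<in> hom1 K a a" "G \<in> hom1 K b b" "X \<in> hom1 K a b" "p \<in> hom2 K (X \<cdot> F) (G \<cdot> X)"
  shows "comonad_2cell F G X p X p (id2 K X)"
  using assms by (simp add: comonad_2cell_def hom_simps whisker_normal)

lemma monad_2cell_vcomp:
  assumes BC: "B \<in> hom1 K a a" "C \<in> hom1 K b b"
    and X: "X \<in> hom1 K a b" "p \<in> hom2 K (C \<cdot> X) (X \<cdot> B)"
    and X': "X' \<in> hom1 K a b" "p' \<in> hom2 K (C \<cdot> X') (X' \<cdot> B)"
    and X'': "X'' \<in> hom1 K a b" "p'' \<in> hom2 K (C \<cdot> X'') (X'' \<cdot> B)"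
    and \<zeta>: "monad_2cell B C X p X' p' \<zeta>" and \<xi>: "monad_2cell B C X' p' X'' p'' \<xi>"
  shows "monad_2cell B C X p X'' p'' (\<xi> \<bullet> \<zeta>)"
proof -
  note [simp] = BC[unfolded hom_simps, simplified] X[unfolded hom_simps, simplified]
    X'[unfolded hom_simps, simplified] X''[unfolded hom_simps, simplified]
  have [simp]: "\<zeta> \<in> Cell2 K" "dom2 K \<zeta> = X" "cod2 K \<zeta> = X'" and \<zeta>_nat: "(\<zeta> \<lhd> B) \<bullet> p = p' \<bullet> (C \<rhd> \<zeta>)"
    using \<zeta> by (simp_all add: monad_2cell_def hom_simps)
  have [simp]: "\<xi> \<in> Cell2 K" "dom2 K \<xi> = X'" "cod2 K \<xi> = X''" and \<xi>_nat: "(\<xi> \<lhd> B) \<bullet> p' = p'' \<bullet> (C \<rhd> \<xi>)"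
    using \<xi> by (simp_all add: monad_2cell_def hom_simps)
  have "((\<xi> \<bullet> \<zeta>) \<lhd> B) \<bullet> p = (\<xi> \<lhd> B) \<bullet> ((\<zeta> \<lhd> B) \<bullet> p)"
    by (simp add: whisker_normal)
  also have "\<dots> = ((\<xi> \<lhd> B) \<bullet> p') \<bullet> (C \<rhd> \<zeta>)"
    by (simp only: \<zeta>_nat) (simp add: whisker_normal)
  also have "\<dots> = p'' \<bullet> (C \<rhd> (\<xi> \<bullet> \<zeta>))"
    by (simp only: \<xi>_nat) (simp add: whisker_normal)
  finally show ?thesis
    by (simp add: monad_2cell_def hom_simps cells)
qed

lemma comonad_2cell_vcomp:
  assumes FG: "F \<in> hom1 K a a" "G \<in> hom1 K b b"
    and X: "X \<in> hom1 K a b" "p \<in> hom2 K (X \<cdot> F) (G \<cdot> X)"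
    and X': "X' \<in> hom1 K a b" "p' \<in> hom2 K (X' \<cdot> F) (G \<cdot> X')"
    and X'': "X'' \<in> hom1 K a b" "p'' \<in> hom2 K (X'' \<cdot> F) (G \<cdot> X'')"
    and \<zeta>: "comonad_2cell F G X p X' p' \<zeta>" and \<xi>: "comonad_2cell F G X' p' X'' p'' \<xi>"
  shows "comonad_2cell F G X p X'' p'' (\<xi> \<bullet> \<zeta>)"
proof -
  note [simp] = FG[unfolded hom_simps, simplified] X[unfolded hom_simps, simplified]
    X'[unfolded hom_simps, simplified] X''[unfolded hom_simps, simplified]
  have [simp]: "\<zeta> \<in> Cell2 K" "dom2 K \<zeta> = X" "cod2 K \<zeta> = X'" and \<zeta>_nat: "(G \<rhd> \<zeta>) \<bullet> p = p' \<bullet> (\<zeta> \<lhd> F)"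
    using \<zeta> by (simp_all add: comonad_2cell_def hom_simps)
  have [simp]: "\<xi> \<in> Cell2 K" "dom2 K \<xi> = X'" "cod2 K \<xi> = X''" and \<xi>_nat: "(G \<rhd> \<xi>) \<bullet> p' = p'' \<bullet> (\<xi> \<lhd> F)"
    using \<xi> by (simp_all add: comonad_2cell_def hom_simps)
  have "(G \<rhd> (\<xi> \<bullet> \<zeta>)) \<bullet> p = (G \<rhd> \<xi>) \<bullet> ((G \<rhd> \<zeta>) \<bullet> p)"
    by (simp add: whisker_normal)
  also have "\<dots> = ((G \<rhd> \<xi>) \<bullet> p') \<bullet> (\<zeta> \<lhd> F)"
    by (simp only: \<zeta>_nat) (simp add: whisker_normal)
  also have "\<dots> = p'' \<bullet> ((\<xi> \<bullet> \<zeta>) \<lhd> F)"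
    by (simp only: \<xi>_nat) (simp add: whisker_normal)
  finally show ?thesis
    by (simp add: comonad_2cell_def hom_simps cells)
qed

section \<open>Identity 1-cells, identity monads and identity comonads\<close>

lemma monad_cell_id1:
  assumes "monad K a B \<mu> \<eta>"
  shows "monad_cell a B \<mu> \<eta> a B \<mu> \<eta> (id1 K a) (id2 K B)"
  using monad.monad_base[OF assms] monad.monad_carrier[OF assms] monad.mult[OF assms] monad.unit[OF assms]
  by (simp add: monad_cell_def hom_simps whisker_normal)

lemma comonad_cell_id1:
  assumes "comonad K a F \<Delta> \<epsilon>"
  shows "comonad_cell a F \<Delta> \<epsilon> a F \<Delta> \<epsilon> (id1 K a) (id2 K F)"
  using comonad.comonad_base[OF assms] comonad.comonad_carrier[OF assms]
    comonad.comult[OF assms] comonad.counit[OF assms]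
  by (simp add: comonad_cell_def hom_simps whisker_normal)

lemma mixed_compatible_id1:
  assumes "a \<in> Cell0 K" "B \<in> hom1 K a a" "F \<in> hom1 K a a" "\<theta> \<in> hom2 K (B \<cdot> F) (F \<cdot> B)"
  shows "mixed_compatible B F \<theta> B F \<theta> (id1 K a) (id2 K B) (id2 K F)"
  using assms by (simp add: mixed_compatible_def hom_simps whisker_normal)

lemma yang_baxter_id1:
  assumes "a \<in> Cell0 K" "B \<in> hom1 K a a" "F \<in> hom1 K a a" "\<theta> \<in> hom2 K (B \<cdot> F) (F \<cdot> B)"
  shows "yang_baxter B F \<theta> B F \<theta> (id1 K a) (id2 K B) (id2 K F)"
  using assms by (simp add: yang_baxter_def hom_simps whisker_normal)

text \<open>This is the source monad when a module is read as a monad cell.\<close>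

lemma identity_monad:
  assumes "a \<in> Cell0 K"
  shows "monad K a (id1 K a) (id2 K (id1 K a)) (id2 K (id1 K a))"
  by standard (use assms in \<open>simp_all add: hom_simps whisker_normal\<close>)

lemma identity_comonad:
  assumes "a \<in> Cell0 K"
  shows "comonad K a (id1 K a) (id2 K (id1 K a)) (id2 K (id1 K a))"
  by standard (use assms in \<open>simp_all add: hom_simps whisker_normal\<close>)

end

section \<open>The action on relative modules\<close>

text \<open>The locale \<open>cat_functor\<close> contains the category laws of its source, which is
  a product both for the tensor product and for the action.\<close>

lemma category_prod_category:
  assumes "category C" "category D"
  shows "category (prod_category C D)"
proof -
  interpret C: category C by fact
  interpret D: category D by fact
  show ?thesis
    by unfold_locales
      (auto simp: prod_category_def C.Idn_in_Hom D.Idn_in_Hom C.Cmp_Idn_left D.Cmp_Idn_left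
        C.Cmp_Idn_right D.Cmp_Idn_right
        intro: C.Cmp_in_Hom D.Cmp_in_Hom C.Cmp_assoc D.Cmp_assoc)
qed

locale relative_setting =
  bimonad K A F \<mu> \<eta> \<Delta> \<epsilon> lam + B: monad K A B \<mu>B \<eta>B
  for K :: "('o, 'f, 'c) two_category" (structure) and A F \<mu> \<eta> \<Delta> \<epsilon> lam B \<mu>B \<eta>B +
  fixes \<psi>BF
  assumes \<psi>BF_Mnd: "(F, \<psi>BF) \<in> Ob (Mnd K A B \<mu>B \<eta>B)"
begin

abbreviation "YD \<equiv> YDs K A F \<mu> \<eta> \<Delta> \<epsilon> lam B \<mu>B \<eta>B \<psi>BF"
abbreviation "RM \<equiv> rel_modules K A F \<Delta> \<epsilon> B \<mu>B \<eta>B \<psi>BF"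
abbreviation "act0 \<equiv> \<lambda>((X, \<psi>F :: 'c, \<phi>, \<psi>B), (M, \<delta>M, \<nu>M)).
  (X \<cdot> M, (\<phi> \<lhd> M) \<bullet> (X \<rhd> \<delta>M), (X \<rhd> \<nu>M) \<bullet> (\<psi>B \<lhd> M))"

lemma F_monad: "monad K A F \<mu> \<eta>"
  and F_comonad: "comonad K A F \<Delta> \<epsilon>"
  and B_monad: "monad K A B \<mu>B \<eta>B"
  and bimonad: "bimonad K A F \<mu> \<eta> \<Delta> \<epsilon> lam"
  by unfold_locales

text \<open>The order matters for the selections below: \<open>A(2,2,4)\<close> and
  \<open>A(3,2,5)\<close> are the triples of two 1-cells and an exchange cell that the hexagon
  lemmas expect.\<close>

lemma ambient_cells:
  "A \<in> Cell0 K" "F \<in> hom1 K A A" "B \<in> hom1 K A A"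
  "lam \<in> hom2 K (F \<cdot> F) (F \<cdot> F)" "\<psi>BF \<in> hom2 K (B \<cdot> F) (F \<cdot> B)"
  using monad_base monad_carrier B.monad_carrier lam_Mnd \<psi>BF_Mnd by (simp_all add: Mnd_def)

section \<open>Objects and morphisms in terms of cells between monads and comonads\<close>

text \<open>This splits the definition into six conditions, each with its own closure lemma. The
  sides of \<open>YD_cond\<close> occur in the opposite order in
  \<open>mixed_compatible\<close>.\<close>

lemma Ob_YD_iff:
  "(X, \<psi>F, \<phi>, \<psi>B) \<in> Ob YD \<longleftrightarrow>
    monad_cell A F \<mu> \<eta> A F \<mu> \<eta> X \<psi>F \<and> comonad_cell A F \<Delta> \<epsilon> A F \<Delta> \<epsilon> X \<phi> \<and>
    monad_cell A B \<mu>B \<eta>B A B \<mu>B \<eta>B X \<psi>B \<and>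
    mixed_compatible F F lam F F lam X \<psi>F \<phi> \<and> mixed_compatible B F \<psi>BF B F \<psi>BF X \<psi>B \<phi> \<and>
    yang_baxter B F \<psi>BF B F \<psi>BF X \<psi>B \<psi>F"
  using bimonad
  by (auto simp: YDs_def strong_YD_module_def strong_YD_module_axioms_def Mnd_def Comnd_def
      monad_cell_def comonad_cell_def mixed_compatible_def yang_baxter_def)

lemma Hom_YD_iff:
  "\<zeta> \<in> Hom YD (X, \<psi>F, \<phi>, \<psi>B) (Y, \<psi>F', \<phi>', \<psi>B') \<longleftrightarrow>
    monad_2cell F F X \<psi>F Y \<psi>F' \<zeta> \<and> comonad_2cell F F X \<phi> Y \<phi>' \<zeta> \<and>
    monad_2cell B B X \<psi>B Y \<psi>B' \<zeta>"
  by (auto simp: YDs_def Mnd_def Comnd_def monad_2cell_def comonad_2cell_def)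

text \<open>Over the identity monad of \<open>src K M\<close> the whiskerings by the source and its
  multiplication are identities, so the laws of a monad cell collapse to those of a module; likewise
  for comodules and the hexagon.\<close>

lemma Ob_RM_iff:
  "(M, \<delta>, \<nu>) \<in> Ob RM \<longleftrightarrow> M \<in> Cell1 K \<and>
    monad_cell (src K M) (id1 K (src K M)) (id2 K (id1 K (src K M))) (id2 K (id1 K (src K M)))
      A B \<mu>B \<eta>B M \<nu> \<and>
    comonad_cell (src K M) (id1 K (src K M)) (id2 K (id1 K (src K M))) (id2 K (id1 K (src K M)))
      A F \<Delta> \<epsilon> M \<delta> \<and>
    mixed_compatible (id1 K (src K M)) (id1 K (src K M)) (id2 K (id1 K (src K M))) B F \<psi>BF M \<nu> \<delta>"
\<comment> \<open>Each side implies this typing. In the first case it enables the conditional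
  rewriting, in the second both sides are false.\<close>
proof (cases "M \<in> Cell1 K \<and> trg K M = A \<and> \<nu> \<in> hom2 K (B \<cdot> M) M \<and> \<delta> \<in> hom2 K M (F \<cdot> M)")
  case True
  then have [simp]: "M \<in> Cell1 K" "trg K M = A" "\<nu> \<in> Cell2 K" "dom2 K \<nu> = B \<cdot> M" "cod2 K \<nu> = M"
      "\<delta> \<in> Cell2 K" "dom2 K \<delta> = M" "cod2 K \<delta> = F \<cdot> M" "src K M \<in> Cell0 K"
    by (auto simp: hom_simps intro: src_in)
  note [simp] = ambient_cells[unfolded hom_simps, simplified]
  show ?thesis
    using F_comonad B_monad
    by (auto simp: rel_modules_def left_comodule_def left_comodule_axioms_def left_module_def
        left_module_axioms_def monad_cell_def comonad_cell_def mixed_compatible_def hom_simps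
        whisker_normal)
next
  case False
  then show ?thesis
    by (auto simp: rel_modules_def left_comodule_def left_comodule_axioms_def left_module_def
        left_module_axioms_def monad_cell_def comonad_cell_def hom_simps comp1_id1)
qed

lemma Hom_RM_iff:
  assumes "(M, \<delta>, \<nu>) \<in> Ob RM" "(N, \<delta>', \<nu>') \<in> Ob RM"
  shows "f \<in> Hom RM (M, \<delta>, \<nu>) (N, \<delta>', \<nu>') \<longleftrightarrow>
    monad_2cell (id1 K (src K M)) B M \<nu> N \<nu>' f \<and>
    comonad_2cell (id1 K (src K M)) F M \<delta> N \<delta>' f"
proof (cases "f \<in> hom2 K M N")
  case True
  then have "(f \<lhd> id1 K (src K M)) = f"
    by (auto simp: hom_simps whisker_right_id1)
  then show ?thesis
    by (auto simp: rel_modules_def monad_2cell_def comonad_2cell_def)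
next
  case False
  then show ?thesis
    by (simp add: rel_modules_def monad_2cell_def)
qed

text \<open>The source of a relative module is arbitrary, but 2-cells are parallel. Modules joined
  by a morphism are therefore cells over one identity monad, as the lemmas on 2-cells
  require.\<close>

lemma Hom_RM_src:
  assumes "f \<in> Hom RM (M, \<delta>, \<nu>) (N, \<delta>', \<nu>')"
  shows "src K N = src K M"
  using assms src_trg_cod2(1)[of f] by (auto simp: rel_modules_def hom_simps)

lemma YD_cells:
  assumes "(X, \<psi>F, \<phi>, \<psi>B) \<in> Ob YD"
  shows "X \<in> hom1 K A A" "\<psi>F \<in> hom2 K (F \<cdot> X) (X \<cdot> F)" "\<phi> \<in> hom2 K (X \<cdot> F) (F \<cdot> X)"
    "\<psi>B \<in> hom2 K (B \<cdot> X) (X \<cdot> B)"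
  using assms by (simp_all add: Ob_YD_iff monad_cell_def comonad_cell_def)

text \<open>Facts 2 and 3 retain the identity 1-cell to match the lemmas on cells; facts 6 and 7
  give the same typings in simplified form.\<close>

lemma RM_cells:
  assumes "(M, \<delta>, \<nu>) \<in> Ob RM"
  shows "M \<in> hom1 K (src K M) A" "\<delta> \<in> hom2 K (M \<cdot> id1 K (src K M)) (F \<cdot> M)"
    "\<nu> \<in> hom2 K (B \<cdot> M) (M \<cdot> id1 K (src K M))" "src K M \<in> Cell0 K"
    "M \<in> Cell1 K" "\<delta> \<in> hom2 K M (F \<cdot> M)" "\<nu> \<in> hom2 K (B \<cdot> M) M"
  using assms by (auto simp: Ob_RM_iff monad_cell_def comonad_cell_def comp1_id1 intro: src_in)

lemma Hom_YD_cell: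
  assumes "\<zeta> \<in> Hom YD (X, \<psi>F, \<phi>, \<psi>B) (Y, \<psi>F', \<phi>', \<psi>B')"
  shows "\<zeta> \<in> hom2 K X Y"
  using assms by (simp add: Hom_YD_iff monad_2cell_def)

lemma Hom_RM_cell:
  assumes "f \<in> Hom RM (M, \<delta>, \<nu>) (N, \<delta>', \<nu>')"
  shows "f \<in> hom2 K M N"
  using assms by (simp add: rel_modules_def)

section \<open>The tensor product and the action are well defined\<close>

lemma Tens0_in_Ob_YD:
  assumes "x \<in> Ob YD" "y \<in> Ob YD"
  shows "Tens0 YD (x, y) \<in> Ob YD"
proof -
  obtain X \<psi>F \<phi> \<psi>B Y \<psi>F' \<phi>' \<psi>B' where x: "x = (X, \<psi>F, \<phi>, \<psi>B)" and y: "y = (Y, \<psi>F', \<phi>', \<psi>B')"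
    by (metis prod_cases4)
  note X = assms(1)[unfolded x] and Y = assms(2)[unfolded y]
  note A = ambient_cells
  have "(X \<cdot> Y, (X \<rhd> \<psi>F') \<bullet> (\<psi>F \<lhd> Y), (\<phi> \<lhd> Y) \<bullet> (X \<rhd> \<phi>'), (X \<rhd> \<psi>B') \<bullet> (\<psi>B \<lhd> Y)) \<in> Ob YD"
    unfolding Ob_YD_iff
    using X[unfolded Ob_YD_iff] Y[unfolded Ob_YD_iff]
      monad_cell_comp[OF F_monad F_monad F_monad] monad_cell_comp[OF B_monad B_monad B_monad]
      comonad_cell_comp[OF F_comonad F_comonad F_comonad]
      mixed_compatible_comp[OF A(2,2,4) A(2,2,4) A(2,2,4) YD_cells(1,2,3)[OF X] YD_cells(1,2,3)[OF Y]]
      mixed_compatible_comp[OF A(3,2,5) A(3,2,5) A(3,2,5) YD_cells(1,4,3)[OF X] YD_cells(1,4,3)[OF Y]]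
      yang_baxter_comp[OF A(3,2,5) A(3,2,5) A(3,2,5) YD_cells(1,4,2)[OF X] YD_cells(1,4,2)[OF Y]]
    by blast
  then show ?thesis
    unfolding x y by (simp add: YDs_def)
qed

text \<open>The composition lemmas apply with \<open>M\<close> as the inner cell, starting at the
  identity monad and comonad of its source, and \<open>X\<close> as the outer cell.\<close>

lemma act0_in_Ob_RM:
  assumes "x \<in> Ob YD" "m \<in> Ob RM"
  shows "act0 (x, m) \<in> Ob RM"
proof -
  obtain X \<psi>F \<phi> \<psi>B M \<delta> \<nu> where x: "x = (X, \<psi>F, \<phi>, \<psi>B)" and m: "m = (M, \<delta>, \<nu>)"
    by (metis prod_cases4 prod_cases3)
  note X = assms(1)[unfolded x] and M = assms(2)[unfolded m]
  note A = ambient_cells and I = id1_in[OF RM_cells(4)[OF M]]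
  \<comment> \<open>This plays the part of \<open>\<theta>\<close> in the hexagon of
    \<open>M\<close>, between two identity 1-cells.\<close>
  have J: "id2 K (id1 K (src K M)) \<in> hom2 K (id1 K (src K M) \<cdot> id1 K (src K M))
      (id1 K (src K M) \<cdot> id1 K (src K M))"
    using RM_cells(4)[OF M] by (simp add: hom_simps cells comp1_id1)
  have XM: "X \<cdot> M \<in> Cell1 K" "src K (X \<cdot> M) = src K M"
    using YD_cells(1)[OF X] RM_cells(1)[OF M] by (simp_all add: hom_simps cells)
  have "(X \<cdot> M, (\<phi> \<lhd> M) \<bullet> (X \<rhd> \<delta>), (X \<rhd> \<nu>) \<bullet> (\<psi>B \<lhd> M)) \<in> Ob RM"
    unfolding Ob_RM_iff XM(2)
    using X[unfolded Ob_YD_iff] M[unfolded Ob_RM_iff] XM(1)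
      monad_cell_comp[OF identity_monad[OF RM_cells(4)[OF M]] B_monad B_monad]
      comonad_cell_comp[OF identity_comonad[OF RM_cells(4)[OF M]] F_comonad F_comonad]
      mixed_compatible_comp[OF I I J A(3,2,5) A(3,2,5) YD_cells(1,4,3)[OF X] RM_cells(1,3,2)[OF M]]
    by blast
  then show ?thesis
    unfolding x m by simp
qed

lemma Tens1_in_Hom_YD:
  assumes "x \<in> Ob YD" "x' \<in> Ob YD" "y \<in> Ob YD" "y' \<in> Ob YD"
    "\<zeta> \<in> Hom YD x x'" "\<xi> \<in> Hom YD y y'"
  shows "\<zeta> \<star> \<xi> \<in> Hom YD (Tens0 YD (x, y)) (Tens0 YD (x', y'))"
proof -
  obtain X p f b X' p' f' b' Y q g c Y' q' g' c' where
    x: "x = (X, p, f, b)" "x' = (X', p', f', b')" and y: "y = (Y, q, g, c)" "y' = (Y', q', g', c')"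
    by (metis prod_cases4)
  note X = assms(1)[unfolded x] and X' = assms(2)[unfolded x]
    and Y = assms(3)[unfolded y] and Y' = assms(4)[unfolded y]
  note A = ambient_cells
  have "\<zeta> \<star> \<xi> \<in> Hom YD
      (X \<cdot> Y, (X \<rhd> q) \<bullet> (p \<lhd> Y), (f \<lhd> Y) \<bullet> (X \<rhd> g), (X \<rhd> c) \<bullet> (b \<lhd> Y))
      (X' \<cdot> Y', (X' \<rhd> q') \<bullet> (p' \<lhd> Y'), (f' \<lhd> Y') \<bullet> (X' \<rhd> g'), (X' \<rhd> c') \<bullet> (b' \<lhd> Y'))"
    unfolding Hom_YD_iff
    using assms(5,6)[unfolded x y Hom_YD_iff]
      monad_2cell_hcomp[OF A(2,2,2) YD_cells(1,2)[OF X] YD_cells(1,2)[OF X'] YD_cells(1,2)[OF Y] YD_cells(1,2)[OF Y']]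
      monad_2cell_hcomp[OF A(3,3,3) YD_cells(1,4)[OF X] YD_cells(1,4)[OF X'] YD_cells(1,4)[OF Y] YD_cells(1,4)[OF Y']]
      comonad_2cell_hcomp[OF A(2,2,2) YD_cells(1,3)[OF X] YD_cells(1,3)[OF X'] YD_cells(1,3)[OF Y] YD_cells(1,3)[OF Y']]
    by blast
  then show ?thesis
    unfolding x y by (simp add: YDs_def)
qed

text \<open>Both ends are objects by \<open>act0_in_Ob_RM\<close>, so \<open>Hom_RM_iff\<close>
  reduces the claim to horizontal composites of 2-cells over the common source.\<close>

lemma act1_in_Hom_RM:
  assumes "x \<in> Ob YD" "x' \<in> Ob YD" "m \<in> Ob RM" "m' \<in> Ob RM"
    "\<zeta> \<in> Hom YD x x'" "h \<in> Hom RM m m'"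
  shows "\<zeta> \<star> h \<in> Hom RM (act0 (x, m)) (act0 (x', m'))"
proof -
  obtain X p f b X' p' f' b' M \<delta> \<nu> M' \<delta>' \<nu>' where
    x: "x = (X, p, f, b)" "x' = (X', p', f', b')" and m: "m = (M, \<delta>, \<nu>)" "m' = (M', \<delta>', \<nu>')"
    by (metis prod_cases4 prod_cases3)
  note X = assms(1)[unfolded x] and X' = assms(2)[unfolded x]
    and M = assms(3)[unfolded m] and M' = assms(4)[unfolded m]
  note A = ambient_cells and I = id1_in[OF RM_cells(4)[OF M]]
  have src: "src K M' = src K M"
    using Hom_RM_src assms(6)[unfolded m] .
  note M'_cells = RM_cells[OF M', unfolded src]
  have XM: "src K (X \<cdot> M) = src K M"
    using YD_cells(1)[OF X] RM_cells(1)[OF M] by (simp_all add: hom_simps cells)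
  have "\<zeta> \<star> h \<in> Hom RM (X \<cdot> M, (f \<lhd> M) \<bullet> (X \<rhd> \<delta>), (X \<rhd> \<nu>) \<bullet> (b \<lhd> M))
      (X' \<cdot> M', (f' \<lhd> M') \<bullet> (X' \<rhd> \<delta>'), (X' \<rhd> \<nu>') \<bullet> (b' \<lhd> M'))"
    unfolding Hom_RM_iff[OF act0_in_Ob_RM[OF X M, simplified] act0_in_Ob_RM[OF X' M', simplified]] XM
    using assms(5)[unfolded x Hom_YD_iff] assms(6)[unfolded m Hom_RM_iff[OF M M']]
      monad_2cell_hcomp[OF I A(3,3) YD_cells(1,4)[OF X] YD_cells(1,4)[OF X'] RM_cells(1,3)[OF M] M'_cells(1,3)]
      comonad_2cell_hcomp[OF I A(2,2) YD_cells(1,3)[OF X] YD_cells(1,3)[OF X'] RM_cells(1,2)[OF M] M'_cells(1,2)]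
    by blast
  then show ?thesis
    unfolding x m by simp
qed

section \<open>The two categories\<close>

text \<open>Unit and associativity laws are inherited from vertical composition in \<open>K\<close>;
  the content is that the hom-sets contain identities and composites.\<close>

lemma category_YD: "category YD"
proof
  note A = ambient_cells
  fix x assume "x \<in> Ob YD"
  moreover obtain X p f b where x: "x = (X, p, f, b)" by (metis prod_cases4)
  ultimately have X: "(X, p, f, b) \<in> Ob YD" by simp
  have "id2 K X \<in> Hom YD (X, p, f, b) (X, p, f, b)"
    unfolding Hom_YD_iff
    using monad_2cell_id2[OF A(2,2) YD_cells(1,2)[OF X]] monad_2cell_id2[OF A(3,3) YD_cells(1,4)[OF X]]
      comonad_2cell_id2[OF A(2,2) YD_cells(1,3)[OF X]]
    by blast
  then show "Idn YD x \<in> Hom YD x x"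
    unfolding x by (simp add: YDs_def)
next
  note A = ambient_cells
  fix x y z \<zeta> \<xi>
  assume obs: "x \<in> Ob YD" "y \<in> Ob YD" "z \<in> Ob YD" and homs: "\<zeta> \<in> Hom YD x y" "\<xi> \<in> Hom YD y z"
  obtain X p f b X' p' f' b' X'' p'' f'' b'' where
    x: "x = (X, p, f, b)" "y = (X', p', f', b')" "z = (X'', p'', f'', b'')"
    by (metis prod_cases4)
  note X = obs(1)[unfolded x] and X' = obs(2)[unfolded x] and X'' = obs(3)[unfolded x]
  have "\<xi> \<bullet> \<zeta> \<in> Hom YD x z"
    unfolding x Hom_YD_iff
    using homs[unfolded x Hom_YD_iff]
      monad_2cell_vcomp[OF A(2,2) YD_cells(1,2)[OF X] YD_cells(1,2)[OF X'] YD_cells(1,2)[OF X'']]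
      monad_2cell_vcomp[OF A(3,3) YD_cells(1,4)[OF X] YD_cells(1,4)[OF X'] YD_cells(1,4)[OF X'']]
      comonad_2cell_vcomp[OF A(2,2) YD_cells(1,3)[OF X] YD_cells(1,3)[OF X'] YD_cells(1,3)[OF X'']]
    by blast
  then show "Cmp YD \<xi> \<zeta> \<in> Hom YD x z"
    by (simp add: YDs_def)
next
  fix x y \<zeta>
  assume "\<zeta> \<in> Hom YD x y"
  moreover obtain X p f b X' p' f' b' where "x = (X, p, f, b)" "y = (X', p', f', b')"
    by (metis prod_cases4)
  ultimately show "Cmp YD (Idn YD y) \<zeta> = \<zeta>" "Cmp YD \<zeta> (Idn YD x) = \<zeta>"
    using Hom_YD_cell by (auto simp: YDs_def hom_simps vcomp_id2_left vcomp_id2_right)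
next
  fix w x y z \<zeta> \<xi> \<chi>
  assume "\<zeta> \<in> Hom YD w x" "\<xi> \<in> Hom YD x y" "\<chi> \<in> Hom YD y z"
  then show "Cmp YD \<chi> (Cmp YD \<xi> \<zeta>) = Cmp YD (Cmp YD \<chi> \<xi>) \<zeta>"
    \<comment> \<open>The typing is extracted while \<open>YD\<close> is still folded, as
      \<open>Hom_YD_cell\<close> requires; only then is the composition unfolded.\<close>
    by (cases w; cases x; cases y; cases z)
      (auto dest!: Hom_YD_cell simp: hom_simps, simp add: YDs_def vcomp_assoc)
qed

lemma category_RM: "category RM"
proof
  note A = ambient_cells
  fix m assume "m \<in> Ob RM"
  moreover obtain M \<delta> \<nu> where m: "m = (M, \<delta>, \<nu>)" by (metis prod_cases3)
  ultimately have M: "(M, \<delta>, \<nu>) \<in> Ob RM" by simp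
  note I = id1_in[OF RM_cells(4)[OF M]]
  have "id2 K M \<in> Hom RM (M, \<delta>, \<nu>) (M, \<delta>, \<nu>)"
    unfolding Hom_RM_iff[OF M M]
    using monad_2cell_id2[OF I A(3) RM_cells(1,3)[OF M]] comonad_2cell_id2[OF I A(2) RM_cells(1,2)[OF M]]
    by blast
  then show "Idn RM m \<in> Hom RM m m"
    unfolding m by (simp add: rel_modules_def)
next
  note A = ambient_cells
  fix x y z f g
  assume obs: "x \<in> Ob RM" "y \<in> Ob RM" "z \<in> Ob RM" and homs: "f \<in> Hom RM x y" "g \<in> Hom RM y z"
  obtain M \<delta> \<nu> M' \<delta>' \<nu>' M'' \<delta>'' \<nu>'' where
    x: "x = (M, \<delta>, \<nu>)" "y = (M', \<delta>', \<nu>')" "z = (M'', \<delta>'', \<nu>'')"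
    by (metis prod_cases3)
  note M = obs(1)[unfolded x] and M' = obs(2)[unfolded x] and M'' = obs(3)[unfolded x]
  \<comment> \<open>All three modules are rewritten to be cells over the identity 1-cell of
    \<open>src K M\<close>.\<close>
  have src': "src K M' = src K M" and src'': "src K M'' = src K M"
    using Hom_RM_src homs[unfolded x] by metis+
  note I = id1_in[OF RM_cells(4)[OF M]]
  note C = RM_cells[OF M] and C' = RM_cells[OF M', unfolded src'] and C'' = RM_cells[OF M'', unfolded src'']
  have "g \<bullet> f \<in> Hom RM x z"
    unfolding x Hom_RM_iff[OF M M'']
    using homs(1)[unfolded x Hom_RM_iff[OF M M']] homs(2)[unfolded x Hom_RM_iff[OF M' M''] src']
      monad_2cell_vcomp[OF I A(3) C(1,3) C'(1,3) C''(1,3)]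
      comonad_2cell_vcomp[OF I A(2) C(1,2) C'(1,2) C''(1,2)]
    by blast
  then show "Cmp RM g f \<in> Hom RM x z"
    by (simp add: rel_modules_def)
next
  fix x y f
  assume "f \<in> Hom RM x y"
  moreover obtain M \<delta> \<nu> M' \<delta>' \<nu>' where "x = (M, \<delta>, \<nu>)" "y = (M', \<delta>', \<nu>')"
    by (metis prod_cases3)
  ultimately show "Cmp RM (Idn RM y) f = f" "Cmp RM f (Idn RM x) = f"
    using Hom_RM_cell by (auto simp: rel_modules_def hom_simps vcomp_id2_left vcomp_id2_right)
next
  fix w x y z f g h
  assume "f \<in> Hom RM w x" "g \<in> Hom RM x y" "h \<in> Hom RM y z"
  then show "Cmp RM h (Cmp RM g f) = Cmp RM (Cmp RM h g) f"
    by (cases w; cases x; cases y; cases z)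
      (auto dest!: Hom_RM_cell simp: hom_simps, simp add: rel_modules_def vcomp_assoc)
qed

section \<open>Functoriality of the tensor product and of the action\<close>

text \<open>Identities are preserved by \<open>hcomp_id2\<close> and composites by
  \<open>interchange\<close>; the same holds for the action.\<close>

lemma Tens_functor_YD: "cat_functor (prod_category YD YD) YD (Tens0 YD) (Tens1 YD)"
proof (intro cat_functor.intro cat_functor_axioms.intro category_prod_category category_YD)
  fix u v assume "u \<in> Ob (prod_category YD YD)"
  then show "Tens0 YD u \<in> Ob YD"
    using Tens0_in_Ob_YD by (auto simp: prod_category_def)
next
  fix u v \<zeta>
  assume "u \<in> Ob (prod_category YD YD)" "v \<in> Ob (prod_category YD YD)"
    "\<zeta> \<in> Hom (prod_category YD YD) u v"
  \<comment> \<open>Only this field is unfolded, so that \<open>Tens1_in_Hom_YD\<close> still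
    matches the goal.\<close>
  moreover have "Tens1 YD = (\<lambda>(\<zeta>, \<xi>). \<zeta> \<star> \<xi>)"
    by (simp add: YDs_def)
  ultimately show "Tens1 YD \<zeta> \<in> Hom YD (Tens0 YD u) (Tens0 YD v)"
    using Tens1_in_Hom_YD by (auto simp: prod_category_def)
next
  fix u assume "u \<in> Ob (prod_category YD YD)"
  then show "Tens1 YD (Idn (prod_category YD YD) u) = Idn YD (Tens0 YD u)"
    by (auto simp: prod_category_def dest!: YD_cells(1))
      (simp add: YDs_def hom_simps hcomp_id2)
next
  fix u v w \<zeta> \<xi>
  assume "\<zeta> \<in> Hom (prod_category YD YD) u v" "\<xi> \<in> Hom (prod_category YD YD) v w"
    and "u \<in> Ob (prod_category YD YD)"
  then show "Tens1 YD (Cmp (prod_category YD YD) \<xi> \<zeta>) = Cmp YD (Tens1 YD \<xi>) (Tens1 YD \<zeta>)"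
    by (cases u; cases v; cases w)
      (auto simp: prod_category_def dest!: YD_cells(1) Hom_YD_cell,
        simp add: YDs_def hom_simps interchange)
qed

lemma act_functor_RM: "cat_functor (prod_category YD RM) RM act0 (\<lambda>(\<zeta>, f). \<zeta> \<star> f)"
proof (intro cat_functor.intro cat_functor_axioms.intro category_prod_category category_YD category_RM)
  fix u v assume "u \<in> Ob (prod_category YD RM)"
  then show "act0 u \<in> Ob RM"
    using act0_in_Ob_RM by (auto simp: prod_category_def)
next
  fix u v \<zeta>
  assume "u \<in> Ob (prod_category YD RM)" "v \<in> Ob (prod_category YD RM)"
    "\<zeta> \<in> Hom (prod_category YD RM) u v"
  then show "(\<lambda>(\<zeta>, f). \<zeta> \<star> f) \<zeta> \<in> Hom RM (act0 u) (act0 v)"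
    using act1_in_Hom_RM by (auto simp: prod_category_def)
next
  fix u assume "u \<in> Ob (prod_category YD RM)"
  then show "(\<lambda>(\<zeta>, f). \<zeta> \<star> f) (Idn (prod_category YD RM) u) = Idn RM (act0 u)"
    by (auto simp: prod_category_def dest!: YD_cells(1) RM_cells(1))
      (simp add: YDs_def rel_modules_def hom_simps hcomp_id2)
next
  fix u v w \<zeta> \<xi>
  assume "\<zeta> \<in> Hom (prod_category YD RM) u v" "\<xi> \<in> Hom (prod_category YD RM) v w"
    and "u \<in> Ob (prod_category YD RM)"
  then show "(\<lambda>(\<zeta>, f). \<zeta> \<star> f) (Cmp (prod_category YD RM) \<xi> \<zeta>) =
      Cmp RM ((\<lambda>(\<zeta>, f). \<zeta> \<star> f) \<xi>) ((\<lambda>(\<zeta>, f). \<zeta> \<star> f) \<zeta>)"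
    by (cases u; cases v; cases w)
      (auto simp: prod_category_def dest!: YD_cells(1) RM_cells(1) Hom_YD_cell Hom_RM_cell,
        simp add: YDs_def rel_modules_def hom_simps interchange)
qed

section \<open>Associativity and unit laws\<close>

lemma strict_monoidal_category_YD: "strict_monoidal_category YD"
proof (intro strict_monoidal_category.intro strict_monoidal_category_axioms.intro category_YD Tens_functor_YD)
  note [simp] = ambient_cells[unfolded hom_simps, simplified]
  have "(id1 K A, id2 K F, id2 K F, id2 K B) \<in> Ob YD"
    unfolding Ob_YD_iff
    using monad_cell_id1[OF F_monad] monad_cell_id1[OF B_monad] comonad_cell_id1[OF F_comonad]
      mixed_compatible_id1 yang_baxter_id1 ambient_cells
    by blast
  then show "Unit YD \<in> Ob YD"
    by (simp add: YDs_def)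
  fix x assume x: "x \<in> Ob YD"
  obtain X p f b where x_eq: "x = (X, p, f, b)"
    by (metis prod_cases4)
  note [simp] = YD_cells[OF x[unfolded x_eq], unfolded hom_simps, simplified]
  show "Tens0 YD (Unit YD, x) = x" "Tens0 YD (x, Unit YD) = x"
    unfolding x_eq by (simp_all add: YDs_def whisker_normal)
  fix y z assume yz: "y \<in> Ob YD" "z \<in> Ob YD"
  \<comment> \<open>Objects carry their structure cells, so equality of the 1-cells is not enough;
    the structure cells agree because they have the same whiskered normal form.\<close>
  show "Tens0 YD (Tens0 YD (x, y), z) = Tens0 YD (x, Tens0 YD (y, z))"
  proof -
    obtain Y p' f' b' Z p'' f'' b'' where
      xyz: "y = (Y, p', f', b')" "z = (Z, p'', f'', b'')"
      by (metis prod_cases4)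
    note [simp] = YD_cells[OF yz(1)[unfolded xyz], unfolded hom_simps, simplified]
      YD_cells[OF yz(2)[unfolded xyz], unfolded hom_simps, simplified]
    show ?thesis
      unfolding x_eq xyz by (simp add: YDs_def whisker_normal)
  qed
  fix x' y' z' \<zeta> \<xi> \<chi> assume "\<zeta> \<in> Hom YD x x'" "\<xi> \<in> Hom YD y y'" "\<chi> \<in> Hom YD z z'"
  then show "Tens1 YD (Tens1 YD (\<zeta>, \<xi>), \<chi>) = Tens1 YD (\<zeta>, Tens1 YD (\<xi>, \<chi>))"
    using x yz
    by (cases x; cases x'; cases y; cases y'; cases z; cases z')
      (auto dest!: Hom_YD_cell YD_cells(1) simp: hom_simps, simp add: YDs_def hcomp_assoc)
next
  fix x y \<zeta> assume "x \<in> Ob YD" "\<zeta> \<in> Hom YD x y"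
  then show "Tens1 YD (Idn YD (Unit YD), \<zeta>) = \<zeta>" "Tens1 YD (\<zeta>, Idn YD (Unit YD)) = \<zeta>"
    by (cases x; cases y, auto dest!: Hom_YD_cell YD_cells(1) simp: hom_simps,
        simp add: YDs_def whisker_left_id1 whisker_right_id1)+
qed

text \<open>The coaction and action on \<open>X \<cdot> M\<close> have the form of the structure
  cells of a tensor product with \<open>M\<close> as second factor, so the laws again follow by
  comparing normal forms.\<close>

lemma strict_action_RM: "strict_action YD RM act0 (\<lambda>(\<zeta>, f). \<zeta> \<star> f)"
proof (intro strict_action.intro strict_action_axioms.intro strict_monoidal_category_YD category_RM
    act_functor_RM)
  note [simp] = ambient_cells[unfolded hom_simps, simplified]
  fix m assume m: "m \<in> Ob RM"
  obtain M \<delta> \<nu> where m_eq: "m = (M, \<delta>, \<nu>)"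
    by (metis prod_cases3)
  \<comment> \<open>Facts 2 and 3 are left out, since their composites with the identity 1-cell
    would compete with the plain typings as rewrite rules.\<close>
  note [simp] = RM_cells(1,4-)[OF m[unfolded m_eq], unfolded hom_simps, simplified]
  show "act0 (Unit YD, m) = m"
    unfolding m_eq by (simp add: YDs_def whisker_normal)
  fix x y assume xy: "x \<in> Ob YD" "y \<in> Ob YD"
  show "act0 (Tens0 YD (x, y), m) = act0 (x, act0 (y, m))"
  proof -
    obtain X p f b Y p' f' b' where xy_eq: "x = (X, p, f, b)" "y = (Y, p', f', b')"
      by (metis prod_cases4)
    note [simp] = YD_cells[OF xy(1)[unfolded xy_eq], unfolded hom_simps, simplified]
      YD_cells[OF xy(2)[unfolded xy_eq], unfolded hom_simps, simplified]
    show ?thesis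
      unfolding m_eq xy_eq by (simp add: YDs_def whisker_normal)
  qed
  fix x' y' m' \<zeta> \<xi> f assume "\<zeta> \<in> Hom YD x x'" "\<xi> \<in> Hom YD y y'" "f \<in> Hom RM m m'"
  then show "(\<lambda>(\<zeta>, f). \<zeta> \<star> f) (Tens1 YD (\<zeta>, \<xi>), f) =
      (\<lambda>(\<zeta>, f). \<zeta> \<star> f) (\<zeta>, (\<lambda>(\<zeta>, f). \<zeta> \<star> f) (\<xi>, f))"
    using xy m
    by (cases x; cases x'; cases y; cases y'; cases m; cases m')
      (auto dest!: Hom_YD_cell YD_cells(1) Hom_RM_cell RM_cells(1) simp: hom_simps,
        simp add: YDs_def hcomp_assoc)
next
  fix m m' f assume "m \<in> Ob RM" "f \<in> Hom RM m m'"
  then show "(\<lambda>(\<zeta>, f). \<zeta> \<star> f) (Idn YD (Unit YD), f) = f"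
    by (cases m; cases m', auto dest!: Hom_RM_cell RM_cells(1) simp: hom_simps)
      (simp add: YDs_def whisker_left_id1)
qed

end

theorem theorem7p6:
  fixes K :: "('o, 'f, 'c) two_category" (structure)
    and A :: 'o and F B :: 'f
    and \<mu> \<eta> \<Delta> \<epsilon> lam \<mu>B \<eta>B \<psi>BF :: 'c
  assumes "bimonad K A F \<mu> \<eta> \<Delta> \<epsilon> lam"
    and "monad K A B \<mu>B \<eta>B"
    and "(F, \<psi>BF) \<in> Ob (Mnd K A B \<mu>B \<eta>B)"
  shows "strict_action
    (YDs K A F \<mu> \<eta> \<Delta> \<epsilon> lam B \<mu>B \<eta>B \<psi>BF)
    (rel_modules K A F \<Delta> \<epsilon> B \<mu>B \<eta>B \<psi>BF)
    (\<lambda>((X, \<psi>F, \<phi>, \<psi>B), (M, \<delta>M, \<nu>M)).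
      (X \<cdot> M, (\<phi> \<lhd> M) \<bullet> (X \<rhd> \<delta>M), (X \<rhd> \<nu>M) \<bullet> (\<psi>B \<lhd> M)))
    (\<lambda>(\<zeta>, f). \<zeta> \<star> f)"
  using assms
  by (intro relative_setting.strict_action_RM relative_setting.intro relative_setting_axioms.intro)

end
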